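(* The characters of the irreducible highest weight Virasoro modules $M\left(\frac12,0\right)$ and $M\left(\frac12,\frac12\right)$ of central charge $\frac12$ are given by $$ch_qM\Big(\frac12,0\Big)=\frac{1}{\prod_{i=1}^{\infty}(1-q^{2i})}\sum_{\substack{n\in\mathbb{Z}\\ n\text{ even}}}q^{n^2+\frac n2},$$ $$ch_qM\Big(\frac12,\frac12\Big)=\frac{1}{\prod_{i=1}^{\infty}(1-q^{2i})}\sum_{\substack{n\in\mathbb{Z}\\ n\text{ odd}}}q^{n^2+\frac n2}.$$
   Context: The Virasoro algebra is the complex Lie algebra with generators $L_n$, $n\in\mathbb{Z}$, and central element $C$, with $[L_m,L_n]=(m-n)L_{m+n}+\delta_{m,-n}\frac{m^3-m}{12}C$. $M(c,h)$ denotes the irreducible highest weight module generated by a vector $v_h$ with $Cv_h=cv_h$, $L_0v_h=hv_h$, and $L_nv_h=0$ for $n>0$. The character of a highest weight module $V$ with highest weight $(c,h)$ is the formal series $ch_qV=tr_Vq^{L_0}=\sum_{j\ge 0}(\dim V_{h+j})q^{h+j}$, where $V_{h+j}$ is the $L_0$-eigenspace of eigenvalue $h+j$. The identities are identities of formal power series in $q^{1/2}$. *)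

theory Defs
  imports "HOL-Analysis.Analysis" "HOL-Library.Poly_Mapping"
    "HOL-Computational_Algebra.Formal_Power_Series"
begin

section \<open>Lie algebras and their modules\<close>

locale lie_algebra = vector_space scale
  for scale :: "'k::field \<Rightarrow> 'g::ab_group_add \<Rightarrow> 'g" +
  fixes bracket :: "'g \<Rightarrow> 'g \<Rightarrow> 'g"
  assumes bracket_linear_left: "Vector_Spaces.linear scale scale (\<lambda>x. bracket x y)"
    and bracket_linear_right: "Vector_Spaces.linear scale scale (bracket x)"
    and bracket_self: "bracket x x = 0"
    and jacobi: "bracket x (bracket y z) + bracket y (bracket z x) + bracket z (bracket x y) = 0"

locale lie_module = lie_algebra scaleG bracket + V: vector_space scale
  for scaleG :: "'k::field \<Rightarrow> 'g::ab_group_add \<Rightarrow> 'g"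
    and bracket :: "'g \<Rightarrow> 'g \<Rightarrow> 'g"
    and scale :: "'k \<Rightarrow> 'v::ab_group_add \<Rightarrow> 'v" +
  fixes act :: "'g \<Rightarrow> 'v \<Rightarrow> 'v"
  assumes act_linear_left: "Vector_Spaces.linear scaleG scale (\<lambda>x. act x v)"
    and act_linear_right: "Vector_Spaces.linear scale scale (act x)"
    and act_bracket: "act (bracket x y) v = act x (act y v) - act y (act x v)"
begin

definition submodule :: "'v set \<Rightarrow> bool" where
  "submodule W \<longleftrightarrow> V.subspace W \<and> (\<forall>x. \<forall>w\<in>W. act x w \<in> W)"

definition irreducible_module :: bool where
  "irreducible_module \<longleftrightarrow>
     (UNIV :: 'v set) \<noteq> {0} \<and> (\<forall>W. submodule W \<longrightarrow> W = {0} \<or> W = UNIV)"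

end


section \<open>The Virasoro algebra\<close>

datatype vir_gen = Lgen int | Cgen

text \<open>Elements are the finite complex linear combinations of the generators.\<close>

type_synonym virasoro = "vir_gen \<Rightarrow>\<^sub>0 complex"

definition vir_scale :: "complex \<Rightarrow> virasoro \<Rightarrow> virasoro" where
  "vir_scale a x = Poly_Mapping.map ((*) a) x"

definition vir_L :: "int \<Rightarrow> virasoro" where
  "vir_L n = Poly_Mapping.single (Lgen n) 1"

definition vir_C :: virasoro where
  "vir_C = Poly_Mapping.single Cgen 1"

fun vir_gen_bracket :: "vir_gen \<Rightarrow> vir_gen \<Rightarrow> virasoro" where
  "vir_gen_bracket (Lgen m) (Lgen n) =
     vir_scale (of_int (m - n)) (vir_L (m + n)) +
     (if m = - n then vir_scale (of_int (m ^ 3 - m) / 12) vir_C else 0)"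
| "vir_gen_bracket Cgen _ = 0"
| "vir_gen_bracket _ Cgen = 0"

text \<open>The bilinear extension of the bracket of generators.\<close>

definition vir_bracket :: "virasoro \<Rightarrow> virasoro \<Rightarrow> virasoro" where
  "vir_bracket x y =
     (\<Sum>a\<in>Poly_Mapping.keys x. \<Sum>b\<in>Poly_Mapping.keys y.
        vir_scale (Poly_Mapping.lookup x a * Poly_Mapping.lookup y b) (vir_gen_bracket a b))"

lemma lookup_vir_scale [simp]:
  "Poly_Mapping.lookup (vir_scale a x) k = a * Poly_Mapping.lookup x k"
  by (simp add: vir_scale_def Poly_Mapping.map.rep_eq when_def)

interpretation vir: vector_space vir_scale
  by unfold_locales (auto intro!: poly_mapping_eqI simp: lookup_add algebra_simps)

lemma vir_bracket_superset:
  assumes "finite A" "finite B" "Poly_Mapping.keys x \<subseteq> A" "Poly_Mapping.keys y \<subseteq> B"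
  shows "vir_bracket x y = (\<Sum>a\<in>A. \<Sum>b\<in>B.
    vir_scale (Poly_Mapping.lookup x a * Poly_Mapping.lookup y b) (vir_gen_bracket a b))"
proof -
  have "vir_bracket x y = (\<Sum>a\<in>Poly_Mapping.keys x. \<Sum>b\<in>B.
      vir_scale (Poly_Mapping.lookup x a * Poly_Mapping.lookup y b) (vir_gen_bracket a b))"
    unfolding vir_bracket_def
    by (intro sum.cong refl sum.mono_neutral_left) (use assms in \<open>auto simp: in_keys_iff\<close>)
  also have "\<dots> = (\<Sum>a\<in>A. \<Sum>b\<in>B.
      vir_scale (Poly_Mapping.lookup x a * Poly_Mapping.lookup y b) (vir_gen_bracket a b))"
    by (intro sum.mono_neutral_left) (use assms in \<open>auto simp: in_keys_iff\<close>)
  finally show ?thesis .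
qed

lemma vir_bracket_add_left: "vir_bracket (x + x') y = vir_bracket x y + vir_bracket x' y"
proof -
  let ?A = "Poly_Mapping.keys x \<union> Poly_Mapping.keys x'" and ?B = "Poly_Mapping.keys y"
  have "Poly_Mapping.keys (x + x') \<subseteq> ?A" by (rule Poly_Mapping.keys_add)
  then show ?thesis
    by (simp add: vir_bracket_superset[of ?A ?B] lookup_add ring_distribs
        vir.scale_left_distrib sum.distrib)
qed

lemma vir_bracket_add_right: "vir_bracket x (y + y') = vir_bracket x y + vir_bracket x y'"
proof -
  let ?A = "Poly_Mapping.keys x" and ?B = "Poly_Mapping.keys y \<union> Poly_Mapping.keys y'"
  have "Poly_Mapping.keys (y + y') \<subseteq> ?B" by (rule Poly_Mapping.keys_add)
  then show ?thesis
    by (simp add: vir_bracket_superset[of ?A ?B] lookup_add ring_distribs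
        vir.scale_left_distrib sum.distrib)
qed

lemma keys_vir_scale: "Poly_Mapping.keys (vir_scale a x) \<subseteq> Poly_Mapping.keys x"
  by (auto simp: in_keys_iff)

lemma vir_bracket_scale_left: "vir_bracket (vir_scale a x) y = vir_scale a (vir_bracket x y)"
proof -
  let ?A = "Poly_Mapping.keys x" and ?B = "Poly_Mapping.keys y"
  show ?thesis
    using keys_vir_scale[of a x]
    by (simp add: vir_bracket_superset[of ?A ?B] vir.scale_sum_right mult.assoc)
qed

lemma vir_bracket_scale_right: "vir_bracket x (vir_scale a y) = vir_scale a (vir_bracket x y)"
proof -
  let ?A = "Poly_Mapping.keys x" and ?B = "Poly_Mapping.keys y"
  show ?thesis
    using keys_vir_scale[of a y]
    by (simp add: vir_bracket_superset[of ?A ?B] vir.scale_sum_right mult.left_commute)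
qed

lemma vir_bracket_zero [simp]: "vir_bracket 0 y = 0" "vir_bracket x 0 = 0"
  by (simp_all add: vir_bracket_def)

lemma vir_bracket_single:
  "vir_bracket (Poly_Mapping.single a 1) (Poly_Mapping.single b 1) = vir_gen_bracket a b"
  by (simp add: vir_bracket_def)

lemma vir_bracket_L_L:
  "vir_bracket (vir_L m) (vir_L n) = vir_scale (of_int (m - n)) (vir_L (m + n)) +
     (if m = - n then vir_scale (of_int (m ^ 3 - m) / 12) vir_C else 0)"
  unfolding vir_L_def vir_bracket_single by (simp add: vir_L_def)

lemma vir_bracket_C [simp]:
  "vir_bracket vir_C (vir_L n) = 0" "vir_bracket (vir_L n) vir_C = 0" "vir_bracket vir_C vir_C = 0"
  unfolding vir_L_def vir_C_def vir_bracket_single by simp_all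

lemma vir_induct [case_names add scale L C]:
  assumes add: "\<And>x y. P x \<Longrightarrow> P y \<Longrightarrow> P (x + y)"
    and scale: "\<And>a x. P x \<Longrightarrow> P (vir_scale a x)"
    and L: "\<And>n. P (vir_L n)" and C: "P vir_C"
  shows "P x"
proof (induction x rule: update_induct)
  case const
  have "vir_scale 0 vir_C = 0" by simp
  then show ?case using scale[OF C, of 0] by simp
next
  case (update f a b)
  have gen: "P (Poly_Mapping.single a 1)"
    using L C by (cases a) (auto simp: vir_L_def vir_C_def)
  have "Poly_Mapping.update a b f = f + vir_scale b (Poly_Mapping.single a 1)"
    using update(1)
    by (intro poly_mapping_eqI) (auto simp: lookup_add lookup_update lookup_single in_keys_iff)
  then show ?case using add[OF update(3) scale[OF gen]] by simp
qed

lemma lookup_vir_L: "Poly_Mapping.lookup (vir_L n) k = (if k = Lgen n then 1 else 0)"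
  by (auto simp: vir_L_def lookup_single when_def)

lemma lookup_vir_C: "Poly_Mapping.lookup vir_C k = (if k = Cgen then 1 else 0)"
  by (auto simp: vir_C_def lookup_single when_def)

lemmas vir_bracket_bilinear =
  vir_bracket_add_left vir_bracket_add_right vir_bracket_scale_left vir_bracket_scale_right

lemma vir_bracket_skew: "vir_bracket x y = - vir_bracket y x"
proof (induction x rule: vir_induct)
  case (L n)
  show ?case
  proof (induction y rule: vir_induct)
    case (L m)
    show ?case
    proof (rule poly_mapping_eqI)
      fix k
      show "Poly_Mapping.lookup (vir_bracket (vir_L n) (vir_L m)) k =
          Poly_Mapping.lookup (- vir_bracket (vir_L m) (vir_L n)) k"
        by (cases k) (auto simp: vir_bracket_L_L lookup_add lookup_minus lookup_vir_L lookup_vir_C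
            power3_eq_cube field_simps)
    qed
  qed (simp_all add: vir_bracket_bilinear)
next
  case C
  show ?case
    by (induction y rule: vir_induct) (simp_all add: vir_bracket_bilinear)
qed (simp_all add: vir_bracket_bilinear)

lemma vir_bracket_L_bracket:
  "vir_bracket (vir_L l) (vir_bracket (vir_L m) (vir_L n)) =
     vir_scale (of_int ((m - n) * (l - m - n))) (vir_L (l + m + n)) +
     (if l + m + n = 0 then vir_scale (of_int ((m - n) * (l ^ 3 - l)) / 12) vir_C else 0)"
proof -
  have "vir_bracket (vir_L l) (vir_bracket (vir_L m) (vir_L n)) =
      vir_scale (of_int (m - n)) (vir_bracket (vir_L l) (vir_L (m + n)))"
    by (simp add: vir_bracket_L_L[of m n] vir_bracket_bilinear)
  also have "l = - (m + n) \<longleftrightarrow> l + m + n = 0" by auto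
  ultimately show ?thesis
    by (simp add: vir_bracket_L_L[of l] vir.scale_right_distrib add.assoc diff_diff_eq)
qed

lemma vir_jacobi_L:
  "vir_bracket (vir_L l) (vir_bracket (vir_L m) (vir_L n)) +
   vir_bracket (vir_L m) (vir_bracket (vir_L n) (vir_L l)) +
   vir_bracket (vir_L n) (vir_bracket (vir_L l) (vir_L m)) = 0"
proof (rule poly_mapping_eqI)
  fix k
  have rot: "m + n + l = l + m + n" "n + l + m = l + m + n" by simp_all
  have "(m - n) * (l - m - n) + (n - l) * (m - n - l) + (l - m) * (n - l - m) = 0"
    by (simp add: algebra_simps)
  then have 1: "(of_int ((m - n) * (l - m - n)) + of_int ((n - l) * (m - n - l)) +
      of_int ((l - m) * (n - l - m)) :: complex) = 0"
    by (metis of_int_0 of_int_add)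
  have "(m - n) * (l ^ 3 - l) + (n - l) * (m ^ 3 - m) + (l - m) * (n ^ 3 - n) = 0"
    if "l + m + n = 0"
  proof -
    have n: "n = - l - m" using that by simp
    show ?thesis unfolding n by (simp add: algebra_simps power3_eq_cube)
  qed
  then have 2: "(of_int ((m - n) * (l ^ 3 - l)) / 12 + of_int ((n - l) * (m ^ 3 - m)) / 12 +
      of_int ((l - m) * (n ^ 3 - n)) / 12 :: complex) = 0" if "l + m + n = 0"
    using that by (metis of_int_0 of_int_add add_divide_distrib div_0)
  show "Poly_Mapping.lookup (vir_bracket (vir_L l) (vir_bracket (vir_L m) (vir_L n)) +
      vir_bracket (vir_L m) (vir_bracket (vir_L n) (vir_L l)) +
      vir_bracket (vir_L n) (vir_bracket (vir_L l) (vir_L m))) k = Poly_Mapping.lookup 0 k"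
    unfolding vir_bracket_L_bracket rot lookup_add
    using 1 2 by (cases k) (auto simp: lookup_vir_L lookup_vir_C simp del: of_int_mult of_int_diff)
qed

lemma vir_jacobi:
  "vir_bracket x (vir_bracket y z) + vir_bracket y (vir_bracket z x) +
   vir_bracket z (vir_bracket x y) = 0"
proof -
  define J where "J x y z = vir_bracket x (vir_bracket y z) + vir_bracket y (vir_bracket z x) +
    vir_bracket z (vir_bracket x y)" for x y z
  have J_add: "J (x + x') y z = J x y z + J x' y z" "J x (y + y') z = J x y z + J x y' z"
    "J x y (z + z') = J x y z + J x y z'" for x x' y y' z z'
    by (simp_all add: J_def vir_bracket_bilinear)
  have J_scale: "J (vir_scale a x) y z = vir_scale a (J x y z)"
    "J x (vir_scale a y) z = vir_scale a (J x y z)"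
    "J x y (vir_scale a z) = vir_scale a (J x y z)" for a x y z
    by (simp_all add: J_def vir_bracket_bilinear vir.scale_right_distrib)
  have C_left: "vir_bracket vir_C x = 0" for x
    by (induction x rule: vir_induct) (simp_all add: vir_bracket_bilinear)
  have C_right: "vir_bracket x vir_C = 0" for x
    by (induction x rule: vir_induct) (simp_all add: vir_bracket_bilinear)
  have J_C: "J vir_C y z = 0" "J x vir_C z = 0" "J x y vir_C = 0" for x y z
    by (simp_all add: J_def C_left C_right)
  have "J x y z = 0"
  proof (induction x rule: vir_induct)
    case (L l)
    show ?case
    proof (induction y rule: vir_induct)
      case (L m)
      show ?case
      proof (induction z rule: vir_induct)
        case (L n)
        show ?case unfolding J_def by (rule vir_jacobi_L)
      qed (simp_all add: J_add J_scale J_C)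
    qed (simp_all add: J_add J_scale J_C)
  qed (simp_all add: J_add J_scale J_C)
  then show ?thesis by (simp add: J_def)
qed

interpretation vir: lie_algebra vir_scale vir_bracket
proof (unfold_locales)
  fix x y :: virasoro
  show "vir_bracket x x = 0"
  proof (rule poly_mapping_eqI)
    fix k
    have "Poly_Mapping.lookup (vir_bracket x x) k = - Poly_Mapping.lookup (vir_bracket x x) k"
      using vir_bracket_skew[of x x] by (metis lookup_uminus)
    then show "Poly_Mapping.lookup (vir_bracket x x) k = Poly_Mapping.lookup 0 k" by simp
  qed
qed (simp_all add: vir_bracket_bilinear vir_jacobi)


section \<open>Highest weight modules and characters\<close>

locale virasoro_module = lie_module vir_scale vir_bracket scale act
  for scale :: "complex \<Rightarrow> 'v::ab_group_add \<Rightarrow> 'v"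
    and act :: "virasoro \<Rightarrow> 'v \<Rightarrow> 'v"
begin

definition highest_weight_vector :: "complex \<Rightarrow> complex \<Rightarrow> 'v \<Rightarrow> bool" where
  "highest_weight_vector c h v \<longleftrightarrow> v \<noteq> 0 \<and>
     act vir_C v = scale c v \<and> act (vir_L 0) v = scale h v \<and> (\<forall>n>0. act (vir_L n) v = 0)"

definition generated_by :: "'v \<Rightarrow> bool" where
  "generated_by v \<longleftrightarrow> (\<forall>W. submodule W \<and> v \<in> W \<longrightarrow> W = UNIV)"

definition weight_space :: "complex \<Rightarrow> 'v set" where
  "weight_space \<mu> = {v. act (vir_L 0) v = scale \<mu> v}"

text \<open>
  Characters are formal power series in the variable \<open>fps_X\<close>, which stands for \<open>q\<^sup>1\<^sup>/\<^sup>2\<close>.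
  The coefficient of \<open>q\<^sup>k\<^sup>/\<^sup>2\<close> in the sum over \<open>j\<close> of \<open>(dim V\<^sub>h\<^sub>+\<^sub>j) q\<^sup>h\<^sup>+\<^sup>j\<close> collects the terms with
  \<open>h + j = k / 2\<close>, and there is at most one. This encoding loses no term when
  \<open>2 * h\<close> is a natural number. The weight spaces of a highest weight module are finite-dimensional,
  so the library's convention that \<open>dim\<close> is \<open>0\<close> in infinite dimension plays no role for them.
\<close>

definition character :: "complex \<Rightarrow> complex fps" where
  "character h = Abs_fps (\<lambda>k. \<Sum>j | h + of_nat j = of_nat k / 2.
     of_nat (V.dim (weight_space (h + of_nat j))))"

end

text \<open>
  A module is an \<open>M(c,h)\<close> if it satisfies the following predicate; this determines it up to
  isomorphism.
\<close>

locale irreducible_highest_weight_module = virasoro_module scale act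
  for scale :: "complex \<Rightarrow> 'v::ab_group_add \<Rightarrow> 'v"
    and act :: "virasoro \<Rightarrow> 'v \<Rightarrow> 'v" +
  fixes c h :: complex
  assumes irreducible: "irreducible_module"
    and highest_weight: "\<exists>v. highest_weight_vector c h v \<and> generated_by v"

end

theory Submission
  imports Defs "HOL-Library.FSet"
begin

text \<open>
  At central charge \<open>1/2\<close> the two modules are the even and the odd half of the Fock space of one free
  fermion with modes \<open>\<psi>\<^sub>r\<close>, \<open>r\<close> a half-odd number, on which \<open>L\<^sub>n\<close> acts by the normally ordered sum of
  \<open>(r - n/2) \<psi>\<^sub>n\<^sub>-\<^sub>r \<psi>\<^sub>r\<close> over \<open>r > n/2\<close>. The creation operators \<open>\<psi>\<^sub>-\<^sub>r\<close> give a basis indexed by finite sets of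
  positive half-odd numbers, and the \<open>L\<^sub>0\<close>-weight of a basis vector is the sum of its set. Hence the
  characters are the parts of the product of all \<open>1 + q\<^sup>r\<close> with integral and with half-odd exponents,
  and a specialization of the Jacobi triple product rewrites that product as the theta series
  divided by the product of the \<open>1 - q\<^sup>2\<^sup>i\<close> (\<open>triple_product\<close>).

  The substance is that both halves are irreducible (\<open>fock_parity_irreducible\<close>). The operator
  \<open>L\<^sub>0\<^sup>2 + 2 \<Sum> L\<^sub>-\<^sub>n L\<^sub>n\<close>, the sum over \<open>n > 0\<close>, maps every Virasoro submodule into itself. It is quartic in the
  fermions on its face, but the quartic part cancels: the product \<open>(a - b)(c - d)\<close> of mode differences
  has no totally antisymmetric part. What is left is bilinear and diagonal, and its commutator with
  \<open>\<psi>\<^sub>r\<close> is \<open>-(7/6 r\<^sup>3 + 5/24 r) \<psi>\<^sub>r\<close> (\<open>LL0_psi\<close>). For fixed \<open>a + b \<noteq> 0\<close> the sums of these cubic eigenvalues at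
  \<open>a\<close> and \<open>b\<close> determine the pair \<open>{a, b}\<close>, so a Vandermonde argument extracts each term \<open>\<psi>\<^sub>a \<psi>\<^sub>b\<close> from \<open>L\<^sub>a\<^sub>+\<^sub>b\<close>:
  every Virasoro submodule is stable under all these products (\<open>submodule_psi_psi\<close>). They strip any
  nonzero vector down to the ground state of its parity and build everything up from there.

  An irreducible highest weight module is determined by \<open>(c, h)\<close>, because the submodule generated by
  the pair of highest weight vectors in a product of two such modules is the graph of an
  isomorphism (\<open>dim_weight_space_eq\<close>). So the dimensions can be counted in the Fock space.
\<close>

unbundle fps_syntax and no vec_syntax

section \<open>A case of the Jacobi triple product\<close>

definition qpoch :: "nat \<Rightarrow> complex fps" where
  "qpoch m = (\<Prod>i<m. 1 - fps_X ^ (4 * (i + 1)))"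

text \<open>
  Reciprocals of \<open>q\<close>-factorials, extended by \<open>0\<close> to negative indices as for the Gamma function. With this
  convention the recursion in \<open>qpoch_inv_pred\<close> holds for all integers and sums over \<open>n\<close> need no boundary
  terms.
\<close>

definition qpoch_inv :: "int \<Rightarrow> complex fps" where
  "qpoch_inv m = (if m < 0 then 0 else inverse (qpoch (nat m)))"

definition theta_exp :: "int \<Rightarrow> nat" where
  "theta_exp n = nat (2 * n\<^sup>2 + n)"

lemma abs_le_square: "\<bar>n\<bar> \<le> (n::int)\<^sup>2"
proof (cases "n = 0")
  case False
  then have "\<bar>n\<bar> * 1 \<le> \<bar>n\<bar> * \<bar>n\<bar>" by (intro mult_left_mono) auto
  then show ?thesis by (simp add: power2_eq_square flip: abs_mult)
qed simp

lemma int_theta_exp: "int (theta_exp n) = 2 * n\<^sup>2 + n"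
  using abs_le_square[of n] by (simp add: theta_exp_def)

lemma abs_le_theta_exp: "\<bar>n\<bar> \<le> int (theta_exp n)"
  using abs_le_square[of n] unfolding int_theta_exp by linarith

lemma inj_theta_exp: "inj theta_exp"
proof (rule injI)
  fix n k :: int
  assume "theta_exp n = theta_exp k"
  then have "2 * n\<^sup>2 + n = 2 * k\<^sup>2 + k" by (metis int_theta_exp)
  then have "(n - k) * (2 * (n + k) + 1) = 0" by (simp add: algebra_simps power2_eq_square)
  moreover have "2 * (n + k) + 1 \<noteq> 0" by presburger
  ultimately show "n = k" by simp
qed

lemma even_theta_exp: "even (theta_exp n) \<longleftrightarrow> even n"
  using int_theta_exp[of n] by (metis even_add even_mult_iff even_numeral even_of_nat)

lemma qpoch_nth_0 [simp]: "qpoch m $ 0 = 1"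
  by (induction m) (simp_all add: qpoch_def)

lemma qpoch_Suc: "qpoch (Suc m) = qpoch m * (1 - fps_X ^ (4 * (m + 1)))"
  by (simp add: qpoch_def)

lemma qpoch_inv_pred: "qpoch_inv (m - 1) = (1 - fps_X ^ (4 * nat m)) * qpoch_inv m"
proof -
  consider "m < 0" | "m = 0" | k where "m = int (Suc k)"
    by (metis not_less int_nat_eq nat_0_le of_nat_0 not0_implies_Suc)
  then show ?thesis
  proof cases
    case 3
    have *: "(1 - fps_X ^ (4 * Suc k) :: complex fps) $ 0 \<noteq> 0" by simp
    have "inverse (qpoch (Suc k)) = inverse (qpoch k) * inverse (1 - fps_X ^ (4 * Suc k))"
      by (simp add: qpoch_Suc fps_inverse_mult)
    then have "(1 - fps_X ^ (4 * Suc k)) * inverse (qpoch (Suc k)) =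
        inverse (qpoch k) * (inverse (1 - fps_X ^ (4 * Suc k)) * (1 - fps_X ^ (4 * Suc k)))"
      by (simp only: ac_simps)
    then have "(1 - fps_X ^ (4 * Suc k)) * inverse (qpoch (Suc k)) = inverse (qpoch k)"
      using inverse_mult_eq_1[OF *] by (simp only: mult_1_right)
    moreover have "qpoch_inv (m - 1) = inverse (qpoch k)" "qpoch_inv m = inverse (qpoch (Suc k))" "nat m = Suc k"
      using 3 by (simp_all add: qpoch_inv_def del: of_nat_Suc) (simp_all add: qpoch_inv_def)
    ultimately show ?thesis by (simp only:)
  qed (simp_all add: qpoch_inv_def)
qed

text \<open>
  Up to the factor \<open>qpoch (2 * N)\<close>, the term of index \<open>n\<close> in the finite form of the triple product: a power
  of the variable times the Gaussian binomial coefficient of \<open>2N\<close> over \<open>N + n\<close> in base \<open>X\<^sup>4\<close>.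
\<close>

definition theta_term :: "nat \<Rightarrow> int \<Rightarrow> complex fps" where
  "theta_term N n = fps_X ^ theta_exp n * (qpoch_inv (int N + n) * qpoch_inv (int N - n))"

lemma theta_term_eq_0: "\<bar>n\<bar> > int N \<Longrightarrow> theta_term N n = 0"
  by (auto simp: theta_term_def qpoch_inv_def)

text \<open>
  The two-step Pascal recursion for central Gaussian binomial coefficients. Completing the square in
  the exponents turns the powers of the variable in front into \<open>X\<^sup>4\<^sup>a\<close> and \<open>X\<^sup>4\<^sup>b\<close> with \<open>a = N + 1 + n\<close> and
  \<open>b = N + 1 - n\<close>, after which the claim is a polynomial identity.
\<close>

lemma theta_term_Suc:
  "(1 - fps_X ^ (8 * N + 4)) * (1 - fps_X ^ (8 * N + 8)) * theta_term (Suc N) n =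
     (1 + fps_X ^ (8 * N + 4)) * theta_term N n + fps_X ^ (4 * N + 3) * theta_term N (n - 1)
     + fps_X ^ (4 * N + 1) * theta_term N (n + 1)"
proof -
  consider "n > int N + 1" | "n < - (int N + 1)" | "- (int N + 1) \<le> n" "n \<le> int N + 1" by linarith
  then show ?thesis
  proof cases
    case 3
    define a b where "a = nat (int N + 1 + n)" and "b = nat (int N + 1 - n)"
    have ab: "a + b = 2 * N + 2" "int N + 1 + n = int a" "int N + 1 - n = int b"
      using 3 by (auto simp: a_def b_def)
    define u v where "u = qpoch_inv (int a)" and "v = qpoch_inv (int b)"
    have e1: "fps_X ^ (4 * N + 3) * fps_X ^ theta_exp (n - 1) =
        (fps_X ^ (4 * b) * fps_X ^ theta_exp n :: complex fps)"
    proof -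
      have "int (4 * N + 3 + theta_exp (n - 1)) = int (4 * b + theta_exp n)"
        unfolding of_nat_add int_theta_exp of_nat_mult ab(3)[symmetric]
        by (simp add: power2_eq_square algebra_simps)
      then show ?thesis by (metis of_nat_eq_iff power_add)
    qed
    have e2: "fps_X ^ (4 * N + 1) * fps_X ^ theta_exp (n + 1) =
        (fps_X ^ (4 * a) * fps_X ^ theta_exp n :: complex fps)"
    proof -
      have "int (4 * N + 1 + theta_exp (n + 1)) = int (4 * a + theta_exp n)"
        unfolding of_nat_add int_theta_exp of_nat_mult ab(2)[symmetric]
        by (simp add: power2_eq_square algebra_simps)
      then show ?thesis by (metis of_nat_eq_iff power_add)
    qed
    have pred: "int a - 1 = int N + n" "int b - 1 = int N - n" using ab by simp_all
    have u1: "qpoch_inv (int N + n) = (1 - fps_X ^ (4 * a)) * u"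
      using qpoch_inv_pred[of "int a"] by (simp only: pred u_def nat_int)
    have v1: "qpoch_inv (int N - n) = (1 - fps_X ^ (4 * b)) * v"
      using qpoch_inv_pred[of "int b"] by (simp only: pred v_def nat_int)
    from pred have u2: "qpoch_inv (int N + n - 1) = (1 - fps_X ^ (4 * nat (int a - 1))) * ((1 - fps_X ^ (4 * a)) * u)"
      and v2: "qpoch_inv (int N - n - 1) = (1 - fps_X ^ (4 * nat (int b - 1))) * ((1 - fps_X ^ (4 * b)) * v)"
      using qpoch_inv_pred[of "int a - 1"] qpoch_inv_pred[of "int b - 1"] u1 v1 by simp_all
    have "int (Suc N) + n = int a" "int (Suc N) - n = int b" using ab by simp_all
    then have t0: "theta_term (Suc N) n = fps_X ^ theta_exp n * (u * v)"
      by (simp only: theta_term_def u_def v_def)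
    have t1: "theta_term N n = fps_X ^ theta_exp n * ((1 - fps_X ^ (4 * a)) * u * ((1 - fps_X ^ (4 * b)) * v))"
      by (simp add: theta_term_def u1 v1)
    have idx: "int N - (n - 1) = int b" "int N + (n + 1) = int a"
      "int N + (n - 1) = int N + n - 1" "int N - (n + 1) = int N - n - 1" using ab by simp_all
    have t2: "fps_X ^ (4 * N + 3) * theta_term N (n - 1) = fps_X ^ (4 * b) * fps_X ^ theta_exp n *
        ((1 - fps_X ^ (4 * nat (int a - 1))) * ((1 - fps_X ^ (4 * a)) * u) * v)"
      by (simp only: theta_term_def idx u2 v_def[symmetric] mult.assoc[symmetric] e1)
    have t3: "fps_X ^ (4 * N + 1) * theta_term N (n + 1) = fps_X ^ (4 * a) * fps_X ^ theta_exp n *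
        (u * ((1 - fps_X ^ (4 * nat (int b - 1))) * ((1 - fps_X ^ (4 * b)) * v)))"
      by (simp only: theta_term_def idx v2 u_def[symmetric] mult.assoc[symmetric] e2)
    define Q :: "complex fps" where "Q = fps_X ^ 4"
    have X8: "fps_X ^ (8 * N + 8) = (fps_X ^ (4 * a) * fps_X ^ (4 * b) :: complex fps)"
    proof -
      have "8 * N + 8 = 4 * a + 4 * b" using ab(1) by simp
      then show ?thesis by (simp add: power_add)
    qed
    show ?thesis
    proof (cases "a = 0 \<or> b = 0")
      case True
      then have "4 * nat (int b - 1) = 8 * N + 4 \<or> 4 * nat (int a - 1) = 8 * N + 4" using ab(1) by auto
      then show ?thesis unfolding t0 t1 t2 t3 X8 using True ab(1) by (elim disjE) simp_all
    next
      case False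
      then obtain a' b' where a': "a = Suc a'" and b': "b = Suc b'" by (meson not0_implies_Suc)
      define A B where "A = (fps_X ^ (4 * a') :: complex fps)" and "B = (fps_X ^ (4 * b') :: complex fps)"
      have XA: "fps_X ^ (4 * a) = Q * A" "fps_X ^ (4 * nat (int a - 1)) = A"
        "fps_X ^ (4 * b) = Q * B" "fps_X ^ (4 * nat (int b - 1)) = B"
        by (simp_all add: a' b' A_def B_def Q_def power_add)
      have "8 * N + 4 = 4 + (4 * a' + 4 * b')" using ab(1) a' b' by simp
      then have X4: "fps_X ^ (8 * N + 4) = Q * A * B" by (simp only: power_add A_def B_def Q_def mult.assoc)
      show ?thesis unfolding t0 t1 t2 t3 X8 XA X4 by (simp add: algebra_simps)
    qed
  qed (simp_all add: theta_term_eq_0)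
qed

lemma sum_theta_term_window:
  assumes "{- int N..int N} \<subseteq> W" "finite W"
  shows "(\<Sum>n\<in>W. theta_term N n) = (\<Sum>n=-int N..int N. theta_term N n)"
proof (rule sum.mono_neutral_right[OF assms(2,1)])
  show "\<forall>n\<in>W - {- int N..int N}. theta_term N n = 0"
    by (auto intro!: theta_term_eq_0)
qed

text \<open>
  The finite triple product with \<open>z = X\<close> in base \<open>X\<^sup>4\<close>: its factors \<open>1 + X\<^sup>4\<^sup>i\<^sup>-\<^sup>1\<close> and \<open>1 + X\<^sup>4\<^sup>i\<^sup>-\<^sup>3\<close> together run through
  all odd exponents. Two factors are added at a time, and the recursion above collects the shifts of
  \<open>n\<close>.
\<close>

lemma finite_triple_product:
  "(\<Prod>i<2 * N. 1 + fps_X ^ (2 * i + 1)) = qpoch (2 * N) * (\<Sum>n=-int N..int N. theta_term N n)"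
proof (induction N)
  case 0
  show ?case by (simp add: theta_term_def qpoch_inv_def theta_exp_def qpoch_def)
next
  case (Suc N)
  define S where "S = (\<Sum>n=-int N..int N. theta_term N n)"
  let ?W = "{- int (Suc N)..int (Suc N)}"
  have W0: "(\<Sum>n\<in>?W. theta_term N n) = S"
    unfolding S_def by (rule sum_theta_term_window) auto
  have "(\<Sum>n\<in>?W. theta_term N (n - 1)) = (\<Sum>n\<in>(\<lambda>n. n - 1) ` ?W. theta_term N n)"
    by (subst sum.reindex) (auto simp: inj_on_def)
  also have "\<dots> = S" unfolding S_def by (rule sum_theta_term_window) auto
  finally have W1: "(\<Sum>n\<in>?W. theta_term N (n - 1)) = S" .
  have "(\<Sum>n\<in>?W. theta_term N (n + 1)) = (\<Sum>n\<in>(\<lambda>n. n + 1) ` ?W. theta_term N n)"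
    by (subst sum.reindex) (auto simp: inj_on_def)
  also have "\<dots> = S" unfolding S_def by (rule sum_theta_term_window) auto
  finally have W2: "(\<Sum>n\<in>?W. theta_term N (n + 1)) = S" .
  have "(1 - fps_X ^ (8 * N + 4)) * (1 - fps_X ^ (8 * N + 8)) * (\<Sum>n\<in>?W. theta_term (Suc N) n) =
      (1 + fps_X ^ (8 * N + 4)) * S + fps_X ^ (4 * N + 3) * S + fps_X ^ (4 * N + 1) * S"
    unfolding sum_distrib_left theta_term_Suc sum.distrib
    unfolding sum_distrib_left[symmetric] W0 W1 W2 ..
  also have "\<dots> = (1 + fps_X ^ (4 * N + 1)) * (1 + fps_X ^ (4 * N + 3)) * S"
  proof -
    have "fps_X ^ (8 * N + 4) = (fps_X ^ (4 * N + 1) * fps_X ^ (4 * N + 3) :: complex fps)"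
      unfolding power_add[symmetric] by (rule arg_cong[where f="power _"]) simp
    then show ?thesis by (simp only:) (simp add: algebra_simps)
  qed
  finally have step: "(1 - fps_X ^ (8 * N + 4)) * (1 - fps_X ^ (8 * N + 8)) * (\<Sum>n\<in>?W. theta_term (Suc N) n) =
      (1 + fps_X ^ (4 * N + 1)) * (1 + fps_X ^ (4 * N + 3)) * S" .
  have "(\<Prod>i<2 * Suc N. 1 + fps_X ^ (2 * i + 1)) =
      qpoch (2 * N) * ((1 + fps_X ^ (4 * N + 1)) * (1 + fps_X ^ (4 * N + 3)) * S)"
  proof -
    have "2 * Suc (2 * N) + 1 = 4 * N + 3" "2 * (2 * N) + 1 = 4 * N + 1" by simp_all
    then have "(\<Prod>i<2 * Suc N. 1 + fps_X ^ (2 * i + 1)) =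
        (\<Prod>i<2 * N. 1 + fps_X ^ (2 * i + 1)) * (1 + fps_X ^ (4 * N + 1)) * (1 + fps_X ^ (4 * N + 3) :: complex fps)"
      by (simp only: mult_Suc_right add_2_eq_Suc prod.lessThan_Suc)
    also have "\<dots> = qpoch (2 * N) * ((1 + fps_X ^ (4 * N + 1)) * (1 + fps_X ^ (4 * N + 3)) * S)"
      unfolding Suc.IH S_def[symmetric] by (simp only: ac_simps)
    finally show ?thesis .
  qed
  moreover have "qpoch (2 * Suc N) = qpoch (2 * N) * ((1 - fps_X ^ (8 * N + 4)) * (1 - fps_X ^ (8 * N + 8)))"
  proof -
    have "4 * (Suc (2 * N) + 1) = 8 * N + 8" "4 * (2 * N + 1) = 8 * N + 4" by simp_all
    then show ?thesis by (simp only: mult_Suc_right add_2_eq_Suc qpoch_Suc mult.assoc)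
  qed
  ultimately show ?case by (simp only: step[symmetric]) (simp only: mult.assoc)
qed

definition fps_cong :: "nat \<Rightarrow> complex fps \<Rightarrow> complex fps \<Rightarrow> bool" where
  "fps_cong K f g \<longleftrightarrow> (\<forall>i<K. f $ i = g $ i)"

lemma fps_cong_mult: "fps_cong K f g \<Longrightarrow> fps_cong K f' g' \<Longrightarrow> fps_cong K (f * f') (g * g')"
  unfolding fps_cong_def fps_mult_nth by (intro allI impI sum.cong) auto

lemma fps_cong_sum: "(\<And>x. x \<in> A \<Longrightarrow> fps_cong K (f x) (g x)) \<Longrightarrow> fps_cong K (sum f A) (sum g A)"
  unfolding fps_cong_def fps_sum_nth by (intro allI impI sum.cong) auto

lemma fps_cong_refl [simp]: "fps_cong K f f"
  by (simp add: fps_cong_def)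

lemma fps_cong_sym: "fps_cong K f g \<Longrightarrow> fps_cong K g f"
  by (simp add: fps_cong_def)

lemma fps_cong_trans: "fps_cong K f g \<Longrightarrow> fps_cong K g k \<Longrightarrow> fps_cong K f k"
  by (simp add: fps_cong_def)

lemma fps_cong_X_power: "K \<le> m \<Longrightarrow> fps_cong K (fps_X ^ m * f) (fps_X ^ m * g)"
  by (simp add: fps_cong_def fps_X_power_mult_nth)

lemma fps_cong_inverse:
  assumes "fps_cong K f g" "f $ 0 \<noteq> 0" "g $ 0 \<noteq> 0"
  shows "fps_cong K (inverse f) (inverse g)"
proof -
  have "fps_cong K (inverse f * (inverse g * g)) (inverse g * (inverse f * f))"
    unfolding mult.left_commute[of "inverse g" "inverse f"]
    by (intro fps_cong_mult fps_cong_refl fps_cong_sym[OF assms(1)])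
  then show ?thesis by (simp add: inverse_mult_eq_1 assms)
qed

lemma fps_eqI_cong: "(\<And>K. fps_cong K f g) \<Longrightarrow> f = g"
  by (rule fps_ext) (auto simp: fps_cong_def)

definition euler_fps :: "complex fps" where
  "euler_fps = Abs_fps (\<lambda>n. qpoch n $ n)"

lemma qpoch_nth_stable: "qpoch (i + d) $ i = qpoch i $ i"
  by (induction d) (simp_all add: qpoch_Suc right_diff_distrib fps_X_power_mult_right_nth del: power_Suc)

lemma qpoch_cong_euler: "K \<le> m \<Longrightarrow> fps_cong K (qpoch m) euler_fps"
  unfolding fps_cong_def euler_fps_def
proof (intro allI impI)
  fix i assume "K \<le> m" "i < K"
  then show "qpoch m $ i = Abs_fps (\<lambda>n. qpoch n $ n) $ i"
    using qpoch_nth_stable[of i "m - i"] by simp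
qed

lemma euler_fps_nth_0 [simp]: "euler_fps $ 0 = 1"
  by (simp add: euler_fps_def)

lemma euler_fps_nth_odd: "odd n \<Longrightarrow> euler_fps $ n = 0"
proof -
  have "odd n \<Longrightarrow> qpoch m $ n = 0" for m n
  proof (induction m arbitrary: n)
    case (Suc m)
    then show ?case
      by (auto simp add: qpoch_Suc right_diff_distrib fps_X_power_mult_right_nth simp del: power_Suc)
  qed (auto simp: qpoch_def odd_pos)
  then show "odd n \<Longrightarrow> euler_fps $ n = 0" by (simp add: euler_fps_def)
qed

text \<open>
  Each coefficient of the partial products is eventually constant, which is convergence in the
  topology of formal power series.
\<close>

lemma prodinf_euler: "prodinf (\<lambda>i::nat. 1 - (fps_X\<^sup>2) ^ (2 * (i + 1)) :: complex fps) = euler_fps"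
proof -
  have part: "(\<Prod>i\<le>n. 1 - (fps_X\<^sup>2) ^ (2 * (i + 1)) :: complex fps) = qpoch (Suc n)" for n
    unfolding qpoch_def lessThan_Suc_atMost power_mult[symmetric] by (simp only: mult.assoc[symmetric]) simp
  have "(\<lambda>n. qpoch (Suc n)) \<longlonglongrightarrow> euler_fps"
  proof (rule tendsto_fpsI)
    fix i
    show "\<forall>\<^sub>F n in sequentially. qpoch (Suc n) $ i = euler_fps $ i"
      using eventually_ge_at_top[of i]
    proof eventually_elim
      case (elim n)
      then show ?case using qpoch_cong_euler[of "Suc n" "Suc n"] by (simp add: fps_cong_def)
    qed
  qed
  moreover have "euler_fps \<noteq> 0" using euler_fps_nth_0 by force
  ultimately have "(\<lambda>i::nat. 1 - (fps_X\<^sup>2) ^ (2 * (i + 1)) :: complex fps) has_prod euler_fps"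
    unfolding has_prod_def raw_has_prod_def by (simp only: part add_0_right) simp
  then show ?thesis by (metis has_prod_unique)
qed

definition theta_fps :: "int set \<Rightarrow> complex fps" where
  "theta_fps A = Abs_fps (\<lambda>m. of_bool (m \<in> theta_exp ` A))"

lemma sum_theta_nth:
  "finite F \<Longrightarrow> (\<Sum>n\<in>F. fps_X ^ theta_exp n :: complex fps) $ m = of_bool (m \<in> theta_exp ` F)"
proof (induction F rule: finite_induct)
  case (insert x F)
  then show ?case using inj_theta_exp by (auto simp: inj_def)
qed simp

text \<open>
  The exponents are pairwise distinct, so every coefficient is \<open>0\<close> or \<open>1\<close>.
\<close>

lemma infsum_theta: "infsum (\<lambda>n. fps_X ^ nat (2 * n\<^sup>2 + n)) A = theta_fps A"
proof (rule infsumI, unfold has_sum_def theta_exp_def[symmetric], rule tendsto_fpsI)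
  fix m
  let ?F0 = "A \<inter> {- int m..int m}"
  have "\<forall>\<^sub>F F in finite_subsets_at_top A. finite F \<and> ?F0 \<subseteq> F \<and> F \<subseteq> A"
    unfolding eventually_finite_subsets_at_top by (rule exI[of _ ?F0]) auto
  then show "\<forall>\<^sub>F F in finite_subsets_at_top A. (\<Sum>n\<in>F. fps_X ^ theta_exp n) $ m = theta_fps A $ m"
  proof eventually_elim
    case (elim F)
    have "m \<in> theta_exp ` F \<longleftrightarrow> m \<in> theta_exp ` A"
    proof
      assume "m \<in> theta_exp ` A"
      then obtain n where "n \<in> A" "m = theta_exp n" by auto
      moreover from this have "n \<in> ?F0" using abs_le_theta_exp[of n] by auto
      ultimately show "m \<in> theta_exp ` F" using elim by auto
    qed (use elim in auto)
    then show ?case using elim by (simp add: sum_theta_nth theta_fps_def)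
  qed
qed

text \<open>
  Partitions of \<open>k\<close> into distinct odd parts, where \<open>i\<close> stands for the part \<open>2i + 1\<close>.
\<close>

definition odd_partitions :: "nat \<Rightarrow> nat set set" where
  "odd_partitions k = {A. finite A \<and> (\<Sum>i\<in>A. 2 * i + 1) = k}"

lemma odd_partitions_subset: "A \<in> odd_partitions k \<Longrightarrow> A \<subseteq> {..<k}"
proof
  fix i
  assume A: "A \<in> odd_partitions k" and i: "i \<in> A"
  then have "2 * i + 1 \<le> (\<Sum>i\<in>A. 2 * i + 1)"
    by (intro member_le_sum) (auto simp: odd_partitions_def)
  then show "i \<in> {..<k}" using A by (simp add: odd_partitions_def)
qed

lemma finite_odd_partitions: "finite (odd_partitions k)"
  by (rule finite_subset[of _ "Pow {..<k}"]) (use odd_partitions_subset in auto)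

lemma prod_odd_cong:
  assumes "K \<le> M"
  shows "fps_cong K (\<Prod>i<M. 1 + fps_X ^ (2 * i + 1)) (Abs_fps (\<lambda>k. of_nat (card (odd_partitions k))))"
  unfolding fps_cong_def
proof (intro allI impI)
  fix k assume k: "k < K"
  have "(\<Prod>i<M. 1 + fps_X ^ (2 * i + 1)) = (\<Prod>i<M. fps_X ^ (2 * i + 1) + (1 :: complex fps))"
    by (simp add: add.commute)
  also have "\<dots> = (\<Sum>A\<in>Pow {..<M}. fps_X ^ (\<Sum>i\<in>A. 2 * i + 1))"
    by (subst prod_add) (simp_all add: power_sum del: power_Suc)
  finally have "(\<Prod>i<M. 1 + fps_X ^ (2 * i + 1) :: complex fps) $ k =
      (\<Sum>A\<in>Pow {..<M}. if k = (\<Sum>i\<in>A. 2 * i + 1) then 1 else 0)"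
    by (simp only: fps_sum_nth fps_X_power_nth)
  also have "\<dots> = (\<Sum>A\<in>odd_partitions k. 1)"
  proof (rule sum.mono_neutral_cong_right)
    show "odd_partitions k \<subseteq> Pow {..<M}"
      using odd_partitions_subset[of _ k] k assms by fastforce
  qed (auto simp: odd_partitions_def finite_subset)
  finally show "(\<Prod>i<M. 1 + fps_X ^ (2 * i + 1) :: complex fps) $ k =
      Abs_fps (\<lambda>k. of_nat (card (odd_partitions k))) $ k" by simp
qed

text \<open>
  Modulo \<open>X\<^sup>K\<close> the finite identity for \<open>N = 2K\<close> has already reached its limit: terms with \<open>\<bar>n\<bar> > K\<close> vanish since
  their exponents are at least \<open>\<bar>n\<bar>\<close>, and for the others \<open>N + n\<close> and \<open>N - n\<close> are at least \<open>K\<close>.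
\<close>

lemma triple_product:
  "Abs_fps (\<lambda>k. of_nat (card (odd_partitions k))) * euler_fps = theta_fps UNIV"
proof (rule fps_eqI_cong)
  fix K :: nat
  define N where "N = 2 * K"
  have qi: "fps_cong K (qpoch_inv m) (inverse euler_fps)" if "int K \<le> m" for m
    using that qpoch_cong_euler[of K "nat m"] by (auto simp: qpoch_inv_def intro!: fps_cong_inverse)
  have "fps_cong K (theta_term N n) (fps_X ^ theta_exp n * (inverse euler_fps * inverse euler_fps))" for n
  proof (cases "\<bar>n\<bar> \<le> int K")
    case True
    then show ?thesis unfolding theta_term_def
      by (intro fps_cong_mult fps_cong_refl qi) (auto simp: N_def)
  next
    case False
    then show ?thesis unfolding theta_term_def using abs_le_theta_exp[of n]
      by (intro fps_cong_X_power) auto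
  qed
  then have "fps_cong K (\<Sum>n=-int N..int N. theta_term N n)
      ((\<Sum>n=-int N..int N. fps_X ^ theta_exp n) * (inverse euler_fps * inverse euler_fps))"
    unfolding sum_distrib_right by (intro fps_cong_sum)
  then have "fps_cong K (qpoch (2 * N) * (\<Sum>n=-int N..int N. theta_term N n) * euler_fps)
      (euler_fps * ((\<Sum>n=-int N..int N. fps_X ^ theta_exp n) * (inverse euler_fps * inverse euler_fps)) * euler_fps)"
    by (intro fps_cong_mult fps_cong_refl qpoch_cong_euler) (auto simp: N_def)
  moreover have "euler_fps * ((\<Sum>n=-int N..int N. fps_X ^ theta_exp n) * (inverse euler_fps * inverse euler_fps)) * euler_fps
      = (\<Sum>n=-int N..int N. fps_X ^ theta_exp n) * (inverse euler_fps * euler_fps) * (inverse euler_fps * euler_fps)"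
    by (simp only: ac_simps)
  ultimately have "fps_cong K ((\<Prod>i<2 * N. 1 + fps_X ^ (2 * i + 1)) * euler_fps)
      (\<Sum>n=-int N..int N. fps_X ^ theta_exp n)"
    by (simp only: finite_triple_product inverse_mult_eq_1 euler_fps_nth_0 one_neq_zero not_False_eq_True mult_1_right)
  moreover have "fps_cong K (\<Sum>n=-int N..int N. fps_X ^ theta_exp n) (theta_fps UNIV)"
    unfolding fps_cong_def
  proof (intro allI impI)
    fix i assume "i < K"
    then have "n \<in> {- int N..int N}" if "i = theta_exp n" for n
      using that abs_le_theta_exp[of n] by (auto simp: N_def)
    then have "i \<in> theta_exp ` {- int N..int N} \<longleftrightarrow> i \<in> range theta_exp" by blast
    then show "(\<Sum>n=-int N..int N. fps_X ^ theta_exp n :: complex fps) $ i = theta_fps UNIV $ i"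
      by (simp add: sum_theta_nth theta_fps_def)
  qed
  moreover have "fps_cong K ((\<Prod>i<2 * N. 1 + fps_X ^ (2 * i + 1)) * euler_fps)
      (Abs_fps (\<lambda>k. of_nat (card (odd_partitions k))) * euler_fps)"
    by (intro fps_cong_mult prod_odd_cong) (auto simp: N_def)
  ultimately show "fps_cong K (Abs_fps (\<lambda>k. of_nat (card (odd_partitions k))) * euler_fps) (theta_fps UNIV)"
    by (blast intro: fps_cong_trans fps_cong_sym)
qed

text \<open>
  The Euler product is a series in \<open>X\<^sup>4\<close> and the theta exponent of \<open>n\<close> has the parity of \<open>n\<close>, so the triple
  product identity splits into its even and its odd part.
\<close>

lemma odd_partitions_parity_fps:
  "Abs_fps (\<lambda>k. if even k = p then of_nat (card (odd_partitions k)) else (0 :: complex)) =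
     inverse (prodinf (\<lambda>i::nat. 1 - (fps_X\<^sup>2) ^ (2 * (i + 1)))) *
     infsum (\<lambda>n. fps_X ^ nat (2 * n\<^sup>2 + n)) {n::int. even n = p}"
proof -
  let ?P = "Abs_fps (\<lambda>k. of_nat (card (odd_partitions k))) :: complex fps"
  let ?Pp = "Abs_fps (\<lambda>k. if even k = p then of_nat (card (odd_partitions k)) else 0) :: complex fps"
  have "?Pp * euler_fps = theta_fps {n. even n = p}"
  proof (rule fps_ext)
    fix m
    have "(?Pp * euler_fps) $ m = (\<Sum>i=0..m. if even m = p then ?P $ i * euler_fps $ (m - i) else 0)"
      unfolding fps_mult_nth by (rule sum.cong) (auto simp: euler_fps_nth_odd)
    also have "\<dots> = (if even m = p then (?P * euler_fps) $ m else 0)"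
      by (simp add: fps_mult_nth)
    also have "\<dots> = theta_fps {n. even n = p} $ m"
      unfolding triple_product using even_theta_exp by (auto simp: theta_fps_def)
    finally show "(?Pp * euler_fps) $ m = theta_fps {n. even n = p} $ m" .
  qed
  then have "inverse euler_fps * theta_fps {n. even n = p} = inverse euler_fps * (?Pp * euler_fps)"
    by simp
  also have "\<dots> = ?Pp * (inverse euler_fps * euler_fps)" by (rule mult.left_commute)
  finally have "?Pp = inverse euler_fps * theta_fps {n. even n = p}"
    by (simp only: inverse_mult_eq_1 euler_fps_nth_0 one_neq_zero not_False_eq_True mult_1_right)
  then show ?thesis unfolding prodinf_euler infsum_theta .
qed

section \<open>Highest weight modules\<close>

context virasoro_module
begin

lemma act_add: "act x (v + w) = act x v + act x w"
  using act_linear_right[of x] by (simp add: Vector_Spaces.linear_iff)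

lemma act_scale: "act x (scale a v) = scale a (act x v)"
  using act_linear_right[of x] by (simp add: Vector_Spaces.linear_iff)

lemma act_zero [simp]: "act x 0 = 0"
  using act_scale[of x 0 0] by simp

lemma act_diff: "act x (v - w) = act x v - act x w"
  using act_add[of x v "scale (- 1) w"] act_scale[of x "- 1" w] by simp

lemma add_act: "act (x + y) v = act x v + act y v"
  using act_linear_left[of v] by (simp add: Vector_Spaces.linear_iff)

lemma scale_act: "act (vir_scale a x) v = scale a (act x v)"
  using act_linear_left[of v] by (simp add: Vector_Spaces.linear_iff)

lemma act_L_L:
  "act (vir_L m) (act (vir_L n) v) = act (vir_L n) (act (vir_L m) v)
     + scale (of_int (m - n)) (act (vir_L (m + n)) v)
     + (if m = - n then scale (of_int (m ^ 3 - m) / 12) (act vir_C v) else 0)"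
proof -
  have "act (vir_bracket (vir_L m) (vir_L n)) v = scale (of_int (m - n)) (act (vir_L (m + n)) v)
     + (if m = - n then scale (of_int (m ^ 3 - m) / 12) (act vir_C v) else 0)"
  proof -
    have "act 0 v = 0" using scale_act[of 0 0 v] by simp
    then show ?thesis by (simp add: vir_bracket_L_L add_act scale_act)
  qed
  then show ?thesis by (simp add: act_bracket algebra_simps)
qed

lemma act_C_L: "act vir_C (act (vir_L n) v) = act (vir_L n) (act vir_C v)"
proof -
  have "act 0 v = 0" using scale_act[of 0 0 v] by simp
  then have "act (vir_bracket vir_C (vir_L n)) v = 0" by simp
  then show ?thesis unfolding act_bracket by simp
qed

lemma submoduleI:
  assumes "V.subspace W" "\<And>n w. w \<in> W \<Longrightarrow> act (vir_L n) w \<in> W" "\<And>w. w \<in> W \<Longrightarrow> act vir_C w \<in> W"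
  shows "submodule W"
proof -
  have "\<forall>w\<in>W. act x w \<in> W" for x
    by (induction x rule: vir_induct)
      (use assms in \<open>auto simp: add_act scale_act V.subspace_add V.subspace_scale\<close>)
  then show ?thesis using assms(1) by (simp add: submodule_def)
qed

definition cyclic_submodule :: "'v \<Rightarrow> 'v set" where
  "cyclic_submodule v = \<Inter>{W. submodule W \<and> v \<in> W}"

lemma submodule_cyclic: "submodule (cyclic_submodule v)"
  unfolding submodule_def cyclic_submodule_def
  by (auto intro!: V.subspace_Inter)

lemma in_cyclic: "v \<in> cyclic_submodule v"
  by (simp add: cyclic_submodule_def)

lemma cyclic_minimal: "submodule W \<Longrightarrow> v \<in> W \<Longrightarrow> cyclic_submodule v \<subseteq> W"
  by (auto simp: cyclic_submodule_def)

lemma subspace_weight_space: "V.subspace (weight_space \<mu>)"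
  by (rule V.subspaceI) (auto simp: weight_space_def act_add act_scale V.scale_right_distrib V.scale_left_commute)

text \<open>
  The product of the operators \<open>L\<^sub>0 - \<mu> - j\<close> for \<open>1 \<le> j \<le> n\<close>. It annihilates the weights \<open>\<mu> + 1, \<dots>, \<mu> + n\<close> and is
  invertible on weight \<open>\<mu>\<close>, which separates the top weight space from the rest without a direct sum
  decomposition.
\<close>

fun kill_weights :: "complex \<Rightarrow> nat \<Rightarrow> 'v \<Rightarrow> 'v" where
  "kill_weights \<mu> 0 v = v"
| "kill_weights \<mu> (Suc n) v = kill_weights \<mu> n (act (vir_L 0) v - scale (\<mu> + of_nat (Suc n)) v)"

lemma kill_weights_add: "kill_weights \<mu> n (v + w) = kill_weights \<mu> n v + kill_weights \<mu> n w"
  by (induction n arbitrary: v w)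
    (simp_all only: kill_weights.simps act_add V.scale_right_distrib add_diff_add)

lemma kill_weights_scale: "kill_weights \<mu> n (scale a v) = scale a (kill_weights \<mu> n v)"
proof (induction n arbitrary: v)
  case (Suc n)
  have "act (vir_L 0) (scale a v) - scale (\<mu> + of_nat (Suc n)) (scale a v) =
      scale a (act (vir_L 0) v - scale (\<mu> + of_nat (Suc n)) v)"
    by (simp only: act_scale V.scale_right_diff_distrib V.scale_left_commute[of a])
  then show ?case by (simp only: kill_weights.simps Suc.IH)
qed simp

lemma kill_weights_eigen:
  assumes "act (vir_L 0) v = scale \<nu> v"
  shows "kill_weights \<mu> n v = scale (\<Prod>j=1..n. \<nu> - \<mu> - of_nat j) v"
proof (induction n)
  case (Suc n)
  have "act (vir_L 0) v - scale (\<mu> + of_nat (Suc n)) v = scale (\<nu> - \<mu> - of_nat (Suc n)) v"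
    unfolding assms V.scale_left_diff_distrib[symmetric] by (simp add: diff_diff_eq)
  then have "kill_weights \<mu> (Suc n) v = scale (\<nu> - \<mu> - of_nat (Suc n)) (kill_weights \<mu> n v)"
    by (simp only: kill_weights.simps kill_weights_scale)
  then show ?case by (simp add: Suc.IH mult.commute)
qed simp

text \<open>
  The easy half of the Poincare-Birkhoff-Witt theorem: words in the lowering operators applied to the
  highest weight vector span a submodule. The empty word gives a multiple of \<open>v\<close>, and all other words
  have weights \<open>h + j\<close> with \<open>j \<ge> 1\<close>.
\<close>

lemma hw_cyclic_decomposition:
  assumes v: "highest_weight_vector c h v" and x: "x \<in> cyclic_submodule v"
  shows "\<exists>a y n. x = scale a v + y \<and> kill_weights h n y = 0"
proof -
  define P where "P w = foldr (\<lambda>n. act (vir_L n)) w v" for w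
  have P_Nil: "P [] = v" and P_Cons: "P (n # w) = act (vir_L n) (P w)" for n w
    by (simp_all add: P_def)
  define B where "B = P ` {w. \<forall>n\<in>set w. n < 0}"
  have C: "act vir_C (P w) = scale c (P w)" for w
    by (induction w) (use v in \<open>auto simp: P_Nil P_Cons act_C_L act_scale highest_weight_vector_def\<close>)
  have neg: "act (vir_L n) y \<in> V.span B" if "n < 0" "y \<in> V.span B" for n y
    using that(2)
  proof (induction rule: V.span_induct_alt)
    case (step a b z)
    then obtain w where "b = P w" "\<forall>n\<in>set w. n < 0" by (auto simp: B_def)
    then have "act (vir_L n) b \<in> B" using that(1) unfolding B_def by (intro image_eqI[of _ _ "n # w"]) (auto simp: P_Cons)
    then show ?case using step
      by (simp add: act_add act_scale V.span_add V.span_scale V.span_base)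
  qed (simp add: V.span_zero)
  \<comment> \<open>Moving \<open>L\<^sub>n\<close> past the first letter leaves \<open>L\<^sub>n\<close>, \<open>L\<^sub>n\<^sub>+\<^sub>m\<close> and \<open>C\<close> applied to a shorter word.\<close>
  have L: "act (vir_L n) (P w) \<in> V.span B" if "\<forall>n\<in>set w. n < 0" for n w
    using that
  proof (induction w arbitrary: n)
    case Nil
    have vB: "v \<in> V.span B" by (rule V.span_base) (auto simp: B_def intro!: image_eqI[of _ _ "[]"] simp: P_Nil)
    consider "n > 0" | "n = 0" | "n < 0" by linarith
    then show ?case
      by cases (use v vB neg in \<open>auto simp: P_Nil highest_weight_vector_def V.span_scale V.span_zero\<close>)
  next
    case (Cons m w)
    have w: "P w \<in> V.span B" using Cons.prems by (intro V.span_base) (auto simp: B_def)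
    have "act (vir_L m) (act (vir_L n) (P w)) \<in> V.span B"
      by (rule neg) (use Cons in auto)
    then show ?case using Cons w
      unfolding P_Cons act_L_L[of n m] C by (intro V.span_add) (auto intro: V.span_scale V.span_zero)
  qed
  have lin: "act g y \<in> V.span B" if g: "\<And>b. b \<in> B \<Longrightarrow> act g b \<in> V.span B" and y: "y \<in> V.span B" for g y
    using y by (induction rule: V.span_induct_alt)
      (auto simp: act_add act_scale V.span_zero intro!: V.span_add V.span_scale g)
  have "submodule (V.span B)"
  proof (rule submoduleI)
    show "act (vir_L n) y \<in> V.span B" if "y \<in> V.span B" for n y
    proof (rule lin[OF _ that])
      fix b assume "b \<in> B"
      then obtain w where "b = P w" "\<forall>n\<in>set w. n < 0" by (auto simp: B_def)
      then show "act (vir_L n) b \<in> V.span B" using L by simp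
    qed
    show "act vir_C y \<in> V.span B" if "y \<in> V.span B" for y
    proof (rule lin[OF _ that])
      fix b assume b: "b \<in> B"
      then have "act vir_C b = scale c b" by (auto simp: B_def C)
      then show "act vir_C b \<in> V.span B" using b by (simp add: V.span_scale V.span_base)
    qed
  qed (rule V.subspace_span)
  moreover have "v \<in> V.span B" by (rule V.span_base) (auto simp: B_def intro!: image_eqI[of _ _ "[]"] simp: P_Nil)
  ultimately have "x \<in> V.span B" using cyclic_minimal x by blast
  moreover have wt: "act (vir_L 0) (P w) = scale (h + of_nat (nat (- sum_list w))) (P w) \<and> sum_list w \<le> 0 \<and>
      (w \<noteq> [] \<longrightarrow> sum_list w < 0)"
    if "\<forall>n\<in>set w. n < 0" for w
    using that
  proof (induction w)
    case (Cons m w)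
    have "act (vir_L 0) (P (m # w)) = scale (h + of_nat (nat (- sum_list w)) - of_int m) (P (m # w))"
      using Cons unfolding P_Cons act_L_L[of 0 m]
      by (auto simp: act_scale act_diff V.scale_left_distrib V.scale_left_diff_distrib)
    moreover have "complex_of_nat (nat (- sum_list (m # w))) = of_nat (nat (- sum_list w)) - of_int m"
    proof -
      have "int (nat (- sum_list (m # w))) = int (nat (- sum_list w)) - m" using Cons by auto
      then show ?thesis by (metis of_int_diff of_int_of_nat_eq)
    qed
    ultimately show ?case using Cons by auto
  qed (use v in \<open>auto simp: highest_weight_vector_def P_Nil\<close>)
  have mono: "kill_weights h m y = 0" if "kill_weights h n y = 0" "n \<le> m" for n m y
    using that(2,1)
  proof (induction m arbitrary: rule: dec_induct)
    case (step m)
    have "kill_weights h m (act (vir_L 0) y) = act (vir_L 0) (kill_weights h m y)"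
    proof (induction m arbitrary: y)
      case (Suc m)
      show ?case unfolding kill_weights.simps Suc[symmetric]
        by (simp add: act_diff act_scale)
    qed simp
    moreover have "kill_weights h m (x - z) = kill_weights h m x - kill_weights h m z" for x z
      by (metis add_diff_cancel diff_add_cancel kill_weights_add)
    ultimately show ?case using step by (simp add: kill_weights_scale)
  qed
  show ?thesis using \<open>x \<in> V.span B\<close>
  proof (induction rule: V.span_induct_alt)
    case base
    show ?case by (intro exI[of _ 0]) simp
  next
    case (step a b z)
    then obtain e y n where z: "z = scale e v + y" "kill_weights h n y = 0" by blast
    from step obtain w where w: "b = P w" "\<forall>n\<in>set w. n < 0" by (auto simp: B_def)
    show ?case
    proof (cases "w = []")
      case True
      then have "scale a b + z = scale (a + e) v + y"
        using z w by (simp add: P_Nil V.scale_left_distrib add.assoc)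
      then show ?thesis using z by blast
    next
      case False
      define j where "j = nat (- sum_list w)"
      have j: "j \<ge> 1" "act (vir_L 0) b = scale (h + of_nat j) b"
        using wt[OF w(2)] False by (auto simp: j_def w)
      have "kill_weights h j b = 0"
        unfolding kill_weights_eigen[OF j(2)] using j(1) by (simp add: prod_zero_iff)
      then have "kill_weights h (max n j) (scale a b + y) = 0"
        using mono[of j b "max n j"] mono[OF z(2), of "max n j"]
        by (simp add: kill_weights_add kill_weights_scale)
      moreover have "scale a b + z = scale e v + (scale a b + y)" using z by simp
      ultimately show ?thesis by blast
    qed
  qed
qed

lemma hw_weight_space_cyclic:
  assumes v: "highest_weight_vector c h v" and x: "x \<in> cyclic_submodule v" "x \<in> weight_space h"
  shows "\<exists>a. x = scale a v"
proof -
  obtain a y n where y: "x = scale a v + y" "kill_weights h n y = 0"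
    using hw_cyclic_decomposition[OF v x(1)] by blast
  have "y = x - scale a v" using y by simp
  moreover have "v \<in> weight_space h" using v by (simp add: highest_weight_vector_def weight_space_def)
  ultimately have "y \<in> weight_space h"
    using x subspace_weight_space by (metis V.subspace_diff V.subspace_scale)
  then have "scale (\<Prod>j=1..n. h - h - of_nat j) y = 0"
    using y(2) kill_weights_eigen[of y h h n] by (simp add: weight_space_def)
  moreover have "(\<Prod>j=1..n. h - h - of_nat j :: complex) \<noteq> 0"
    by (simp add: prod_zero_iff)
  ultimately have "y = 0" by (metis V.scale_eq_0_iff)
  then show ?thesis using y by auto
qed

end

lemma virasoro_module_prod:
  assumes "virasoro_module s1 a1" "virasoro_module s2 a2"
  shows "virasoro_module (\<lambda>a p. (s1 a (fst p), s2 a (snd p))) (\<lambda>g p. (a1 g (fst p), a2 g (snd p)))"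
proof -
  interpret A: virasoro_module s1 a1 by fact
  interpret B: virasoro_module s2 a2 by fact
  interpret P: vector_space "\<lambda>a p. (s1 a (fst p), s2 a (snd p))"
    by unfold_locales (simp_all add: A.V.scale_right_distrib A.V.scale_left_distrib
        B.V.scale_right_distrib B.V.scale_left_distrib)
  show ?thesis
    by unfold_locales (simp_all add: A.act_add B.act_add A.act_scale B.act_scale A.add_act B.add_act
        A.scale_act B.scale_act A.act_bracket B.act_bracket)
qed

text \<open>
  Uniqueness of the irreducible highest weight module. Let \<open>N\<close> be the submodule of the product generated
  by \<open>(v, v')\<close>. Its projections are all of both factors. The kernel of either projection is a submodule
  of a factor; if it were the whole factor, \<open>N\<close> would contain \<open>(v, 0)\<close> or \<open>(0, v')\<close>, whereas its weight
  space of weight \<open>h\<close> is the line through \<open>(v, v')\<close>. So \<open>N\<close> is the graph of an isomorphism. The second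
  factor is given as a submodule \<open>U\<close> of a larger module because both parities share one Fock space.
\<close>

lemma dim_weight_space_eq:
  fixes scale :: "complex \<Rightarrow> 'v::ab_group_add \<Rightarrow> 'v"
    and scaleF :: "complex \<Rightarrow> 'f::ab_group_add \<Rightarrow> 'f"
  assumes M: "irreducible_highest_weight_module scale act c h"
    and F: "virasoro_module scaleF actF"
    and v': "virasoro_module.highest_weight_vector scaleF actF c h v'"
    and U: "lie_module.submodule scaleF actF U" "v' \<in> U"
    and irr: "\<And>W. lie_module.submodule scaleF actF W \<Longrightarrow> W \<subseteq> U \<Longrightarrow> W = {0} \<or> W = U"
  shows "vector_space.dim scale (virasoro_module.weight_space scale act \<mu>) =
    vector_space.dim scaleF (virasoro_module.weight_space scaleF actF \<mu> \<inter> U)"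
proof -
  interpret M: irreducible_highest_weight_module scale act c h by fact
  interpret F: virasoro_module scaleF actF by fact
  define sP where "sP = (\<lambda>a p. (scale a (fst p), scaleF a (snd p)))"
  define aP where "aP = (\<lambda>g p. (act g (fst p), actF g (snd p)))"
  interpret P: virasoro_module sP aP
    unfolding sP_def aP_def by (rule virasoro_module_prod) unfold_locales
  obtain v where v: "M.highest_weight_vector c h v" using M.highest_weight by blast
  have vv: "P.highest_weight_vector c h (v, v')"
    unfolding P.highest_weight_vector_def
    using v v' by (auto simp: M.highest_weight_vector_def
        F.highest_weight_vector_def sP_def aP_def zero_prod_def)
  have v0: "v \<noteq> 0" "v' \<noteq> 0" using v v' by (auto simp: M.highest_weight_vector_def F.highest_weight_vector_def)
  define N where "N = P.cyclic_submodule (v, v')"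
  have N: "P.submodule N" "(v, v') \<in> N" by (simp_all add: N_def P.submodule_cyclic P.in_cyclic)
  have N_sub: "P.V.subspace N" using N(1) by (simp add: P.submodule_def)
  have N_add: "(x + x', y + y') \<in> N" if "(x, y) \<in> N" "(x', y') \<in> N" for x x' y y'
    using P.V.subspace_add[OF N_sub that] by simp
  have N_scale: "(scale a x, scaleF a y) \<in> N" if "(x, y) \<in> N" for a x y
    using P.V.subspace_scale[OF N_sub that, of a] unfolding sP_def by simp
  have N_act: "(act g x, actF g y) \<in> N" if "(x, y) \<in> N" for g x y
  proof -
    have "aP g (x, y) \<in> N" using N(1) that by (simp add: P.submodule_def)
    then show ?thesis by (simp add: aP_def)
  qed
  have N_zero: "(0, 0) \<in> N"
    using P.V.subspace_0[OF N_sub] by (simp add: zero_prod_def)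
  have irrM: "W = {0} \<or> W = UNIV" if "M.submodule W" for W
    using M.irreducible that by (simp add: M.irreducible_module_def)
  have "M.submodule (fst ` N)"
    unfolding M.submodule_def
  proof (intro conjI allI ballI M.V.subspaceI)
    show "0 \<in> fst ` N" using N_zero by force
  next
    fix a b assume "a \<in> fst ` N" "b \<in> fst ` N"
    then show "a + b \<in> fst ` N" using N_add by force
  next
    fix e a assume "a \<in> fst ` N"
    then show "scale e a \<in> fst ` N" using N_scale by force
  next
    fix g a assume "a \<in> fst ` N"
    then show "act g a \<in> fst ` N" using N_act by force
  qed
  moreover have "v \<in> fst ` N" using N(2) by force
  ultimately have fstN: "fst ` N = UNIV" using irrM v0 by blast
  have "P.submodule (UNIV \<times> U)"
    using U(1) unfolding P.submodule_def F.submodule_def P.V.subspace_def F.V.subspace_def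
    by (auto simp: sP_def aP_def zero_prod_def)
  then have NU: "N \<subseteq> UNIV \<times> U" unfolding N_def using U(2) by (intro P.cyclic_minimal) auto
  have "F.submodule (snd ` N)"
    unfolding F.submodule_def
  proof (intro conjI allI ballI F.V.subspaceI)
    show "0 \<in> snd ` N" using N_zero by force
  next
    fix a b assume "a \<in> snd ` N" "b \<in> snd ` N"
    then show "a + b \<in> snd ` N" using N_add by force
  next
    fix e a assume "a \<in> snd ` N"
    then show "scaleF e a \<in> snd ` N" using N_scale by force
  next
    fix g a assume "a \<in> snd ` N"
    then show "actF g a \<in> snd ` N" using N_act by force
  qed
  moreover have "v' \<in> snd ` N" using N(2) by force
  ultimately have sndN: "snd ` N = U" using irr[of "snd ` N"] NU v0 by fastforce
  have one_dim: "\<exists>a. (x, y) = sP a (v, v')" if "(x, y) \<in> N" "act (vir_L 0) x = scale h x" "actF (vir_L 0) y = scaleF h y" for x y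
  proof (rule P.hw_weight_space_cyclic[OF vv])
    show "(x, y) \<in> P.cyclic_submodule (v, v')" using that by (simp add: N_def)
    show "(x, y) \<in> P.weight_space h"
      unfolding P.weight_space_def using that by (simp add: sP_def aP_def)
  qed
  have L0: "act (vir_L 0) v = scale h v" "actF (vir_L 0) v' = scaleF h v'"
    using v v' by (auto simp: M.highest_weight_vector_def F.highest_weight_vector_def)
  have ker1: "x = 0" if "(x, 0) \<in> N" for x
  proof -
    have "M.submodule {x. (x, 0) \<in> N}"
      unfolding M.submodule_def M.V.subspace_def
      using N_zero N_add[of _ 0 _ 0] N_scale[of _ 0] N_act[of _ 0] by auto
    moreover have "(v, 0) \<notin> N"
      using one_dim[of v 0] L0 v0 by (auto simp: sP_def)
    ultimately show ?thesis using irrM[of "{x. (x, 0) \<in> N}"] that by blast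
  qed
  have ker2: "y = 0" if "(0, y) \<in> N" for y
  proof -
    have "F.submodule {y. (0, y) \<in> N}"
      unfolding F.submodule_def F.V.subspace_def
      using N_zero N_add[of 0 _ 0] N_scale[of 0] N_act[of 0] by auto
    moreover have "(0, v') \<notin> N"
      using one_dim[of 0 v'] L0 v0 by (auto simp: sP_def)
    moreover have "{y. (0, y) \<in> N} \<subseteq> U" using NU by auto
    ultimately show ?thesis using irr[of "{y. (0, y) \<in> N}"] that U(2) by blast
  qed
  have uniq: "y = y'" if "(x, y) \<in> N" "(x, y') \<in> N" for x y y'
  proof -
    have "(x + scale (-1) x, y + scaleF (-1) y') \<in> N" using that by (intro N_add N_scale)
    then show ?thesis using ker2[of "y - y'"] by simp
  qed
  define \<phi> where "\<phi> x = (THE y. (x, y) \<in> N)" for x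
  have \<phi>: "(x, \<phi> x) \<in> N" for x
  proof -
    have "x \<in> fst ` N" using fstN by simp
    then obtain y where "(x, y) \<in> N" by force
    then have "\<exists>!y. (x, y) \<in> N" using uniq by blast
    then show ?thesis unfolding \<phi>_def by (rule theI')
  qed
  have \<phi>_eq: "\<phi> x = y" if "(x, y) \<in> N" for x y using uniq \<phi> that by blast
  have lin: "Vector_Spaces.linear scale scaleF \<phi>"
    by unfold_locales (auto intro!: \<phi>_eq N_add N_scale \<phi>)
  have \<phi>_act: "\<phi> (act g x) = actF g (\<phi> x)" for g x
    by (intro \<phi>_eq N_act \<phi>)
  have inj: "inj \<phi>"
  proof (rule injI)
    fix x x' assume "\<phi> x = \<phi> x'"
    then have "(x + scale (-1) x', \<phi> x + scaleF (-1) (\<phi> x)) \<in> N"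
      using N_add[OF \<phi>[of x] N_scale[OF \<phi>[of x'], of "- 1"]] \<open>\<phi> x = \<phi> x'\<close> by (simp only:)
    then show "x = x'" using ker1[of "x - x'"] by simp
  qed
  have "\<phi> ` M.weight_space \<mu> = F.weight_space \<mu> \<inter> U"
  proof (intro equalityI subsetI)
    fix y assume "y \<in> \<phi> ` M.weight_space \<mu>"
    then obtain x where x: "y = \<phi> x" "act (vir_L 0) x = scale \<mu> x" by (auto simp: M.weight_space_def)
    have "actF (vir_L 0) y = \<phi> (scale \<mu> x)" by (simp add: x(1) \<phi>_act[symmetric] x(2))
    also have "\<dots> = scaleF \<mu> y" unfolding x(1) by (intro \<phi>_eq N_scale \<phi>)
    finally show "y \<in> F.weight_space \<mu> \<inter> U" using \<phi>[of x] NU x by (auto simp: F.weight_space_def)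
  next
    fix y assume y: "y \<in> F.weight_space \<mu> \<inter> U"
    then obtain x where x: "(x, y) \<in> N" using sndN by force
    have "\<phi> (act (vir_L 0) x) = \<phi> (scale \<mu> x)"
      using y x \<phi>_eq[OF N_act[OF x]] \<phi>_eq[OF N_scale[OF x]] by (simp add: F.weight_space_def)
    then have "x \<in> M.weight_space \<mu>" using inj by (simp add: M.weight_space_def inj_def)
    then show "y \<in> \<phi> ` M.weight_space \<mu>" using \<phi>_eq[OF x] by blast
  qed
  moreover interpret VP: vector_space_pair scale scaleF by unfold_locales
  have "F.V.dim (\<phi> ` M.weight_space \<mu>) = M.V.dim (M.weight_space \<mu>)"
  proof -
    obtain B where B: "B \<subseteq> M.weight_space \<mu>" "M.V.independent B" "M.weight_space \<mu> \<subseteq> M.V.span B"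
      "card B = M.V.dim (M.weight_space \<mu>)"
      using M.V.basis_exists by blast
    have inj_on: "inj_on \<phi> S" for S using inj by (rule inj_on_subset) simp
    show ?thesis
    proof (rule F.V.dim_unique[where B = "\<phi> ` B"])
      show "\<phi> ` M.weight_space \<mu> \<subseteq> F.V.span (\<phi> ` B)"
        using B(3) VP.linear_span_image[OF lin, of B] by blast
      show "F.V.independent (\<phi> ` B)"
        by (rule VP.linear_independent_injective_image[OF lin B(2) inj_on])
    qed (use B inj_on in \<open>auto simp: card_image\<close>)
  qed
  ultimately show ?thesis by simp
qed

section \<open>The fermionic Fock space\<close>

text \<open>
  The basis vector of a finite set \<open>A\<close> has the one-particle states \<open>i \<in> A\<close> occupied, state \<open>i\<close> having energy
  \<open>i + 1/2\<close>.
\<close>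

type_synonym fock = "nat fset \<Rightarrow>\<^sub>0 complex"

definition fock_scale :: "complex \<Rightarrow> fock \<Rightarrow> fock" where
  "fock_scale a u = Poly_Mapping.map ((*) a) u"

lemma lookup_fock_scale [simp]:
  "Poly_Mapping.lookup (fock_scale a u) A = a * Poly_Mapping.lookup u A"
  by (simp add: fock_scale_def Poly_Mapping.map.rep_eq when_def)

interpretation fock: vector_space fock_scale
  by unfold_locales (auto intro!: poly_mapping_eqI simp: lookup_add algebra_simps)

text \<open>
  The integer \<open>k\<close> indexes the fermion mode \<open>r = k + 1/2\<close>, so that negation of modes is \<open>k \<mapsto> - 1 - k\<close>. The state on
  which a mode acts depends on \<open>\<bar>r\<bar>\<close> only.
\<close>

definition mode :: "int \<Rightarrow> nat" where
  "mode k = (if k < 0 then nat (- k - 1) else nat k)"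

definition flip :: "nat \<Rightarrow> nat fset \<Rightarrow> nat fset" where
  "flip m A = (if m |\<in>| A then A |-| {|m|} else finsert m A)"

text \<open>
  The Jordan-Wigner sign, which makes operators on different states anticommute.
\<close>

definition fermi_sign :: "nat \<Rightarrow> nat fset \<Rightarrow> complex" where
  "fermi_sign m A = (\<Prod>j\<in>fset A. if j < m then - 1 else 1)"

lemma flip_flip [simp]: "flip m (flip m A) = A"
  by (auto simp: flip_def)

lemma mem_flip: "n |\<in>| flip m A \<longleftrightarrow> (if n = m then n |\<notin>| A else n |\<in>| A)"
  by (auto simp: flip_def)

lemma flip_commute: "flip m (flip n A) = flip n (flip m A)"
  by (rule fset_eqI) (auto simp: mem_flip)

lemma fermi_sign_flip: "fermi_sign m (flip n A) = (if n < m then - fermi_sign m A else fermi_sign m A)"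
proof (cases "n |\<in>| A")
  case True
  have "fermi_sign m A = (if n < m then - 1 else 1) * (\<Prod>j\<in>fset A - {n}. if j < m then - 1 else 1)"
    unfolding fermi_sign_def using True by (intro prod.remove) auto
  then show ?thesis using True by (simp add: flip_def fermi_sign_def)
qed (simp add: flip_def fermi_sign_def)

lemma fermi_sign_square: "fermi_sign m A * fermi_sign m A = 1"
proof -
  have "fermi_sign m A * fermi_sign m A = (\<Prod>j\<in>fset A. 1)"
    unfolding fermi_sign_def prod.distrib[symmetric] by (rule prod.cong) auto
  then show ?thesis by simp
qed

text \<open>
  Coefficientwise: for \<open>k < 0\<close> the operator creates the state \<open>mode k\<close>, so it contributes to occupied sets, and
  for \<open>k \<ge> 0\<close> it annihilates it, so it contributes to sets in which that state is empty.
\<close>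

lift_definition psi :: "int \<Rightarrow> fock \<Rightarrow> fock" is
  "\<lambda>k f A. if (mode k |\<in>| A) = (k < 0) then fermi_sign (mode k) A * f (flip (mode k) A) else 0"
proof -
  fix k and f :: "nat fset \<Rightarrow> complex"
  assume "finite {A. f A \<noteq> 0}"
  then have "finite (flip (mode k) ` {A. f A \<noteq> 0})" by (rule finite_imageI)
  moreover have "{A. (if (mode k |\<in>| A) = (k < 0) then fermi_sign (mode k) A * f (flip (mode k) A) else 0) \<noteq> 0}
      \<subseteq> flip (mode k) ` {A. f A \<noteq> 0}"
    by (force intro: image_eqI[of _ _ "flip (mode k) A" for A] split: if_splits)
  ultimately show "finite {A. (if (mode k |\<in>| A) = (k < 0)
      then fermi_sign (mode k) A * f (flip (mode k) A) else 0) \<noteq> 0}"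
    by (rule rev_finite_subset)
qed

lemma lookup_psi: "Poly_Mapping.lookup (psi k u) A =
    (if (mode k |\<in>| A) = (k < 0) then fermi_sign (mode k) A * Poly_Mapping.lookup u (flip (mode k) A) else 0)"
  by transfer simp

lemma psi_add: "psi k (u + v) = psi k u + psi k v"
  by (rule poly_mapping_eqI) (simp add: lookup_psi lookup_add algebra_simps)

lemma psi_scale: "psi k (fock_scale a u) = fock_scale a (psi k u)"
  by (rule poly_mapping_eqI) (simp add: lookup_psi)

lemma psi_zero [simp]: "psi k 0 = 0"
  by (rule poly_mapping_eqI) (simp add: lookup_psi)

lemma psi_diff: "psi k (u - v) = psi k u - psi k v"
  by (rule poly_mapping_eqI) (simp add: lookup_psi lookup_minus algebra_simps)

lemma psi_sum: "psi k (sum f S) = (\<Sum>x\<in>S. psi k (f x))"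
  by (induction S rule: infinite_finite_induct) (simp_all add: psi_add)

lemma mode_eq_iff: "mode a = mode b \<longleftrightarrow> a = b \<or> a + b = - 1"
  by (auto simp: mode_def)

theorem psi_anticomm: "psi a (psi b u) + psi b (psi a u) = (if a + b = - 1 then u else 0)"
proof (rule poly_mapping_eqI)
  fix A
  show "Poly_Mapping.lookup (psi a (psi b u) + psi b (psi a u)) A =
      Poly_Mapping.lookup (if a + b = - 1 then u else 0) A"
  proof (cases "mode a = mode b")
    case False
    then have "a + b \<noteq> - 1" by (simp add: mode_eq_iff)
    with False show ?thesis
      by (auto simp: lookup_add lookup_psi mem_flip fermi_sign_flip flip_commute[of "mode a"])
  next
    case True
    then have "a = b \<and> a + b \<noteq> - 1 \<or> a + b = - 1" unfolding mode_eq_iff by presburger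
    then consider "a = b" "a + b \<noteq> - 1" | "a + b = - 1" by blast
    then show ?thesis
    proof cases
      case 2
      then have "(a < 0) = (\<not> b < 0)" by auto
      then show ?thesis using 2 True
        by (auto simp: lookup_add lookup_psi mem_flip fermi_sign_flip fermi_sign_square mult.assoc[symmetric])
    qed (auto simp: lookup_add lookup_psi mem_flip)
  qed
qed

lemma psi_swap: "psi a (psi b u) = (if a + b = - 1 then u else 0) - psi b (psi a u)"
  using psi_anticomm[of a b u] by (simp add: algebra_simps)

lemma psi_psi_same: "psi a (psi a u) = 0"
  by (rule poly_mapping_eqI) (auto simp: lookup_psi mem_flip)

text \<open>
  Every vector is annihilated by all sufficiently high modes. This makes the infinite mode sums below
  finite on each vector and allows a common cutoff for finitely many vectors.
\<close>

definition annihilated_from :: "int \<Rightarrow> fock \<Rightarrow> bool" where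
  "annihilated_from K u \<longleftrightarrow> (\<forall>k\<ge>K. psi k u = 0)"

lemma annihilated_fromD: "annihilated_from K u \<Longrightarrow> K \<le> k \<Longrightarrow> psi k u = 0"
  by (simp add: annihilated_from_def)

lemma annihilated_from_ex: "\<exists>K0. \<forall>K\<ge>K0. annihilated_from K u"
proof -
  have "finite (\<Union>A\<in>Poly_Mapping.keys u. fset A)" by simp
  then obtain M where M: "\<And>m. m \<in> (\<Union>A\<in>Poly_Mapping.keys u. fset A) \<Longrightarrow> m < M"
    unfolding finite_nat_set_iff_bounded by blast
  have "psi k u = 0" if "int M \<le> k" for k
  proof (rule poly_mapping_eqI)
    fix A
    have "Poly_Mapping.lookup u (finsert (mode k) A) = 0"
    proof (rule ccontr)
      assume "Poly_Mapping.lookup u (finsert (mode k) A) \<noteq> 0"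
      then have "mode k < M" by (intro M) (auto simp: in_keys_iff)
      then show False using that by (auto simp: mode_def split: if_splits)
    qed
    then show "Poly_Mapping.lookup (psi k u) A = Poly_Mapping.lookup 0 A"
      using that by (auto simp: lookup_psi flip_def)
  qed
  then show ?thesis by (intro exI[of _ "int M"]) (auto simp: annihilated_from_def)
qed

lemma annihilated_from_psi:
  "annihilated_from K u \<Longrightarrow> K \<le> K' \<Longrightarrow> - 1 - s < K' \<Longrightarrow> annihilated_from K' (psi s u)"
  by (auto simp: annihilated_from_def psi_swap[of _ s])

lemma annihilated_from_add: "annihilated_from K u \<Longrightarrow> annihilated_from K v \<Longrightarrow> annihilated_from K (u + v)"
  by (simp add: annihilated_from_def psi_add)

lemma annihilated_from_scale: "annihilated_from K u \<Longrightarrow> annihilated_from K (fock_scale a u)"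
  by (simp add: annihilated_from_def psi_scale)

definition vac :: fock where
  "vac = Poly_Mapping.single {||} 1"

abbreviation vac_coeff :: "fock \<Rightarrow> complex" where
  "vac_coeff u \<equiv> Poly_Mapping.lookup u {||}"

lemma vac_coeff_vac [simp]: "vac_coeff vac = 1"
  by (simp add: vac_def)

lemma psi_vac: "k \<ge> 0 \<Longrightarrow> psi k vac = 0"
  by (rule poly_mapping_eqI) (auto simp: lookup_psi vac_def lookup_single when_def flip_def)

lemma annihilated_from_vac: "annihilated_from 0 vac"
  by (simp add: annihilated_from_def psi_vac)

lemma vac_coeff_psi: "k < 0 \<Longrightarrow> vac_coeff (psi k u) = 0"
  by (simp add: lookup_psi)

lemma psi_single:
  assumes "m |\<notin>| A"
  shows "psi (- int m - 1) (Poly_Mapping.single A 1) =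
    fock_scale (fermi_sign m A) (Poly_Mapping.single (finsert m A) 1)"
proof (rule poly_mapping_eqI)
  fix B
  have m: "mode (- int m - 1) = m" by (simp add: mode_def)
  show "Poly_Mapping.lookup (psi (- int m - 1) (Poly_Mapping.single A 1)) B =
      Poly_Mapping.lookup (fock_scale (fermi_sign m A) (Poly_Mapping.single (finsert m A) 1)) B"
  proof (cases "B = finsert m A")
    case True
    then have "flip m B = A" using assms by (auto simp: flip_def)
    then show ?thesis using assms True fermi_sign_flip[of m m B] by (simp add: lookup_psi m lookup_single)
  next
    case False
    then show ?thesis by (auto simp: lookup_psi m lookup_single when_def flip_def)
  qed
qed

lemma fock_induct [case_names vac psi add scale]:
  assumes vac: "P vac"
    and psi: "\<And>k u. k < 0 \<Longrightarrow> P u \<Longrightarrow> P (psi k u)"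
    and add: "\<And>u v. P u \<Longrightarrow> P v \<Longrightarrow> P (u + v)"
    and scale: "\<And>a u. P u \<Longrightarrow> P (fock_scale a u)"
  shows "P u"
proof -
  have single: "P (Poly_Mapping.single A 1)" for A
  proof (induction A)
    case empty
    then show ?case using vac by (simp add: vac_def)
  next
    case (insert m A)
    have "P (fock_scale (fermi_sign m A) (psi (- int m - 1) (Poly_Mapping.single A 1)))"
      by (intro scale psi insert) simp
    then show ?case
      by (simp only: psi_single[OF insert(1)] fock.scale_scale fermi_sign_square fock.scale_one)
  qed
  show ?thesis
  proof (induction u rule: update_induct)
    case const
    then show ?case using scale[OF vac, of 0] by simp
  next
    case (update f a b)
    have "Poly_Mapping.update a b f = f + fock_scale b (Poly_Mapping.single a 1)"
      using update(1)
      by (intro poly_mapping_eqI) (auto simp: lookup_add lookup_update lookup_single in_keys_iff)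
    then show ?case using add[OF update(3) scale[OF single]] by simp
  qed
qed

lemma annihilated_imp_vac:
  assumes "annihilated_from 0 u"
  shows "u = fock_scale (vac_coeff u) vac"
proof (rule poly_mapping_eqI)
  fix A
  show "Poly_Mapping.lookup u A = Poly_Mapping.lookup (fock_scale (vac_coeff u) vac) A"
  proof (cases "A = {||}")
    case False
    then obtain m where m: "m |\<in>| A" by auto
    have "psi (int m) u = 0" using assms by (simp add: annihilated_from_def)
    then have "Poly_Mapping.lookup (psi (int m) u) (A |-| {|m|}) = 0" by simp
    moreover have "flip m (A |-| {|m|}) = A" using m by (auto simp: flip_def)
    moreover have "fermi_sign m B \<noteq> 0" for B using fermi_sign_square[of m B] by auto
    ultimately have "Poly_Mapping.lookup u A = 0" by (simp add: lookup_psi mode_def)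
    then show ?thesis using False by (simp add: vac_def lookup_single when_def)
  qed simp
qed

text \<open>
  Schur's lemma for the Clifford algebra. An operator that commutes with all modes up to a factor \<open>\<sigma>\<close> maps
  the vacuum to a vector that all annihilators kill, hence to a multiple of the vacuum, and the
  modes generate everything from there. For \<open>\<sigma> \<noteq> 1\<close> the multiple has to be \<open>0\<close>. Identities between operators
  below are proved by computing commutators and one vacuum coefficient.
\<close>

lemma fock_commutant:
  assumes lin: "\<And>u v. Y (u + v) = Y u + Y v" "\<And>a u. Y (fock_scale a u) = fock_scale a (Y u)"
    and sg: "\<And>s u. Y (psi s u) = fock_scale \<sigma> (psi s (Y u))" "\<sigma> = 1 \<or> vac_coeff (Y vac) = 0" "\<sigma> \<noteq> 0"
  shows "Y u = fock_scale (vac_coeff (Y vac)) u"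
proof (induction u rule: fock_induct)
  case vac
  have "Y 0 = 0" using lin(2)[of 0 0] by simp
  have "annihilated_from 0 (Y vac)"
    unfolding annihilated_from_def
  proof (intro allI impI)
    fix k :: int assume "0 \<le> k"
    then have "fock_scale \<sigma> (psi k (Y vac)) = 0"
      unfolding sg(1)[symmetric] by (simp add: psi_vac \<open>Y 0 = 0\<close>)
    then show "psi k (Y vac) = 0" using sg(3) by (simp only: fock.scale_eq_0_iff simp_thms)
  qed
  then show ?case by (rule annihilated_imp_vac)
next
  case (psi k u)
  then show ?case using sg(1)[of k u] sg(2) by (auto simp: psi_scale)
next
  case (add u v)
  then show ?case by (simp only: lin fock.scale_right_distrib)
next
  case (scale a u)
  then show ?case by (simp only: lin fock.scale_left_commute[of a])
qed

section \<open>The Virasoro action on the Fock space\<close>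

text \<open>
  In terms of modes this is \<open>r - n/2\<close> with \<open>r = k + 1/2\<close>.
\<close>

definition L_coeff :: "int \<Rightarrow> int \<Rightarrow> complex" where
  "L_coeff n k = of_int (2 * k + 1 - n) / 2"

text \<open>
  The condition \<open>n \<le> 2k\<close> says \<open>r > n/2\<close>. It picks each unordered pair of modes with sum \<open>n\<close> once and puts the
  higher mode on the right, which is normal ordering. Pairs of equal modes are left out, as their
  square is \<open>0\<close>.
\<close>

definition L :: "int \<Rightarrow> fock \<Rightarrow> fock" where
  "L n u = (\<Sum>k | n \<le> 2 * k \<and> psi k u \<noteq> 0. fock_scale (L_coeff n k) (psi (n - k - 1) (psi k u)))"

lemma half_le_iff: "(n + 1) div 2 \<le> k \<longleftrightarrow> n \<le> 2 * (k::int)"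
  by presburger

lemma L_window:
  assumes "annihilated_from K u"
  shows "L n u = (\<Sum>k=(n + 1) div 2..<K. fock_scale (L_coeff n k) (psi (n - k - 1) (psi k u)))"
  unfolding L_def
proof (rule sum.mono_neutral_left)
  show "{k. n \<le> 2 * k \<and> psi k u \<noteq> 0} \<subseteq> {(n + 1) div 2..<K}"
    using assms by (auto simp: half_le_iff annihilated_from_def not_le[symmetric])
qed (auto simp: half_le_iff)

lemma L_add: "L n (u + v) = L n u + L n v"
proof -
  obtain K1 K2 where "\<forall>K\<ge>K1. annihilated_from K u" "\<forall>K\<ge>K2. annihilated_from K v"
    using annihilated_from_ex by metis
  then have "annihilated_from (max K1 K2) u" "annihilated_from (max K1 K2) v" by simp_all
  then show ?thesis
    by (simp add: L_window[of "max K1 K2"] annihilated_from_add psi_add fock.scale_right_distrib sum.distrib)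
qed

lemma L_scale: "L n (fock_scale a u) = fock_scale a (L n u)"
proof -
  obtain K where "annihilated_from K u" using annihilated_from_ex by blast
  then show ?thesis
    by (simp add: L_window[of K] annihilated_from_scale psi_scale fock.scale_sum_right mult.commute)
qed

lemma L_zero [simp]: "L n 0 = 0"
  by (simp add: L_def)

lemma L_diff: "L n (u - v) = L n u - L n v"
  using L_add[of n u "fock_scale (- 1) v"] L_scale[of n "- 1" v] by simp

lemma L_sum: "L n (sum f S) = (\<Sum>x\<in>S. L n (f x))"
  by (induction S rule: infinite_finite_induct) (simp_all add: L_add)

text \<open>
  The fermion is a primary field of weight \<open>1/2\<close>. Only the terms of the sum that contain the mode opposite
  to \<open>\<psi>\<^sub>s\<close> fail to commute with it. They are those at \<open>k = - 1 - s\<close> and \<open>k = n + s\<close>, of which at most one lies in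
  the range of summation; both have coefficient \<open>0\<close> if none does.
\<close>

theorem L_psi: "L n (psi s u) = psi s (L n u) - fock_scale (of_int (2 * s + 1 + n) / 2) (psi (n + s) u)"
proof -
  obtain K0 where K0: "\<forall>K\<ge>K0. annihilated_from K u" using annihilated_from_ex by blast
  define K where "K = max K0 (\<bar>n\<bar> + \<bar>s\<bar> + 1)"
  have K: "annihilated_from K u" "- 1 - s < K" "n + s < K" using K0 by (auto simp: K_def)
  have Ks: "annihilated_from K (psi s u)" using annihilated_from_psi[OF K(1) order_refl K(2)] .
  have move: "psi (n - k - 1) (psi k (psi s u)) = psi s (psi (n - k - 1) (psi k u))
      + (if k = - 1 - s then psi (n + s) u else 0) - (if k = n + s then psi (n + s) u else 0)" for k
  proof -
    have "psi (n - k - 1) (psi k (psi s u)) =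
        psi (n - k - 1) (if k + s = - 1 then u else 0) - psi (n - k - 1) (psi s (psi k u))"
      by (simp add: psi_swap[of k s] psi_diff)
    also have "psi (n - k - 1) (psi s (psi k u)) =
        (if n - k - 1 + s = - 1 then psi k u else 0) - psi s (psi (n - k - 1) (psi k u))"
      by (rule psi_swap)
    also have "psi (n - k - 1) (if k + s = - 1 then u else 0) = (if k = - 1 - s then psi (n + s) u else 0)"
      by auto
    also have "(if n - k - 1 + s = - 1 then psi k u else 0) = (if k = n + s then psi (n + s) u else 0)"
      by auto
    finally show ?thesis by (simp only: diff_diff_eq2 diff_add_eq add.commute)
  qed
  have W: "- 1 - s \<in> {(n + 1) div 2..<K} \<longleftrightarrow> n \<le> - 2 - 2 * s"
    "n + s \<in> {(n + 1) div 2..<K} \<longleftrightarrow> - 2 * s \<le> n" using K by (auto simp: half_le_iff)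
  show ?thesis
  proof (rule poly_mapping_eqI)
    fix A
    let ?l = "\<lambda>u::fock. Poly_Mapping.lookup u A"
    have "?l (L n (psi s u)) = (\<Sum>k=(n + 1) div 2..<K. L_coeff n k * ?l (psi s (psi (n - k - 1) (psi k u)))
        + (if k = - 1 - s then L_coeff n (- 1 - s) * ?l (psi (n + s) u) else 0)
        - (if k = n + s then L_coeff n (n + s) * ?l (psi (n + s) u) else 0))"
      unfolding L_window[OF Ks] move lookup_sum
      by (rule sum.cong) (auto simp: lookup_add lookup_minus ring_distribs)
    also have "\<dots> = ?l (psi s (L n u))
        + (if n \<le> - 2 - 2 * s then L_coeff n (- 1 - s) * ?l (psi (n + s) u) else 0)
        - (if - 2 * s \<le> n then L_coeff n (n + s) * ?l (psi (n + s) u) else 0)"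
      unfolding sum.distrib sum_subtractf
      by (simp add: W[simplified] L_window[OF K(1)] psi_sum psi_scale lookup_sum)
    also have "\<dots> = ?l (psi s (L n u)) - of_int (2 * s + 1 + n) / 2 * ?l (psi (n + s) u)"
    proof -
      consider "n \<le> - 2 - 2 * s" | "n = - 1 - 2 * s" | "- 2 * s \<le> n" by linarith
      then show ?thesis by cases (auto simp: L_coeff_def field_simps)
    qed
    finally show "?l (L n (psi s u)) =
        ?l (psi s (L n u) - fock_scale (of_int (2 * s + 1 + n) / 2) (psi (n + s) u))"
      by (simp add: lookup_minus)
  qed
qed

lemma L_vac: "n \<ge> - 1 \<Longrightarrow> L n vac = 0"
  unfolding L_window[OF annihilated_from_vac] by (intro sum.neutral) (auto simp: half_le_iff)

lemma vac_coeff_L: "n \<le> 1 \<Longrightarrow> vac_coeff (L n u) = 0"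
  unfolding L_def lookup_sum by (intro sum.neutral) (auto simp: vac_coeff_psi)

text \<open>
  This sum of squares is where the central term \<open>(m\<^sup>3 - m) c / 12\<close> with \<open>c = 1/2\<close> comes from.
\<close>

lemma sum_squares_L_coeff:
  "(\<Sum>k=(1 - int m) div 2..<0. (L_coeff (- int m) k)\<^sup>2) = (of_nat m ^ 3 - of_nat m) / 24"
proof (induction m rule: nat_less_induct)
  case (1 m)
  show ?case
  proof (cases "m < 2")
    case True
    then have "m = 0 \<or> m = 1" by auto
    then show ?thesis by auto
  next
    case False
    then obtain j where j: "m = j + 2" by (metis add.commute le_Suc_ex not_less)
    have "(\<Sum>k=(1 - int m) div 2..<0. (L_coeff (- int m) k)\<^sup>2) =
        (\<Sum>k=(1 - int j) div 2..<1. (L_coeff (- int j) k)\<^sup>2)"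
      by (rule sum.reindex_bij_witness[of _ "\<lambda>k. k - 1" "\<lambda>k. k + 1"])
        (auto simp: j L_coeff_def algebra_simps)
    also have "{(1 - int j) div 2..<1} = insert 0 {(1 - int j) div 2..<0}"
      by auto
    finally have rec: "(\<Sum>k=(1 - int m) div 2..<0. (L_coeff (- int m) k)\<^sup>2) =
        (L_coeff (- int j) 0)\<^sup>2 + (of_nat j ^ 3 - of_nat j) / 24"
      using 1[rule_format, of j] j by simp
    show ?thesis unfolding rec
      by (simp add: j L_coeff_def power2_eq_square power3_eq_cube field_simps)
  qed
qed

text \<open>
  Commuting \<open>L\<^sub>m\<close> past the first fermion of a term of \<open>L\<^sub>n\<close> contracts the pair; what remains begins with a
  creation operator and has no vacuum component.
\<close>

lemma vac_coeff_L_L_vac: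
  assumes "m \<ge> 2" "n \<le> - 2"
  shows "vac_coeff (L m (L n vac)) = (if m = - n then of_int (m ^ 3 - m) / 24 else 0)"
proof -
  have coeff: "vac_coeff (L m (psi (n - k - 1) (psi k vac))) =
      (if m = - n then L_coeff n k else 0)" if "(n + 1) div 2 \<le> k" "k < 0" for k
  proof -
    have neg: "n - k - 1 < 0" using that assms by (simp add: half_le_iff)
    have "vac_coeff (psi (m + (n - k - 1)) (psi k vac)) = (if m = - n then 1 else 0)"
      unfolding psi_swap[of _ k] using that by (simp add: lookup_minus vac_coeff_psi)
    moreover have "of_int (2 * (n - k - 1) + 1 + m) / 2 = - L_coeff n k" if "m = - n"
      using that by (simp add: L_coeff_def field_simps)
    ultimately show ?thesis
      unfolding L_psi[of m "n - k - 1"] lookup_minus lookup_fock_scale vac_coeff_psi[OF neg]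
      by simp
  qed
  have "vac_coeff (L m (L n vac)) = (\<Sum>k=(n + 1) div 2..<0. L_coeff n k * (if m = - n then L_coeff n k else 0))"
    unfolding L_window[OF annihilated_from_vac, of n] L_sum L_scale lookup_sum
    by (rule sum.cong) (auto simp: coeff)
  also have "\<dots> = (if m = - n then of_int (m ^ 3 - m) / 24 else 0)"
  proof (cases "m = - n")
    case True
    then obtain j where j: "m = int j" "n = - int j" using assms by (metis int_eq_iff minus_minus order_trans zero_le_numeral)
    then show ?thesis using sum_squares_L_coeff[of j] by (simp add: power2_eq_square)
  qed simp
  finally show ?thesis .
qed

text \<open>
  The commutator minus its expected non-central part commutes with all fermion modes by \<open>L_psi\<close>, so it is a
  scalar, which the vacuum coefficient identifies.
\<close>

theorem L_L: "L m (L n u) - L n (L m u) =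
    fock_scale (of_int (m - n)) (L (m + n) u) + (if m = - n then fock_scale (of_int (m ^ 3 - m) / 24) u else 0)"
proof -
  define X where "X m n u = L m (L n u) - L n (L m u) - fock_scale (of_int (m - n)) (L (m + n) u)" for m n u
  have X_psi: "X m n (psi s u) = psi s (X m n u)" for m n s u
  proof (rule poly_mapping_eqI)
    fix A
    have idx: "n + (m + s) = m + n + s" "m + (n + s) = m + n + s" by simp_all
    show "Poly_Mapping.lookup (X m n (psi s u)) A = Poly_Mapping.lookup (psi s (X m n u)) A"
      unfolding X_def L_psi L_diff L_scale psi_diff psi_scale lookup_minus lookup_fock_scale idx
      by (simp add: field_simps)
  qed
  have X_scalar: "X m n u = fock_scale (vac_coeff (X m n vac)) u" for m n u
  proof (rule fock_commutant[where \<sigma> = 1])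
    show "X m n (u + v) = X m n u + X m n v" for u v
      by (simp add: X_def L_add fock.scale_right_distrib)
    show "X m n (fock_scale a u) = fock_scale a (X m n u)" for a u
      by (simp add: X_def L_scale fock.scale_right_diff_distrib mult.commute)
  qed (simp_all add: X_psi)
  have X_vac: "vac_coeff (X m n vac) = (if m = - n then of_int (m ^ 3 - m) / 24 else 0)"
    if "m \<ge> 2" "n \<le> - 2" for m n
  proof -
    have "vac_coeff (L (m + n) vac) = 0"
      by (cases "m + n \<le> 1") (simp_all add: vac_coeff_L L_vac)
    then show ?thesis using that by (simp add: X_def lookup_minus vac_coeff_L_L_vac L_vac)
  qed
  have X_swap: "X m n u = - X n m u" for m n u
    by (rule poly_mapping_eqI) (simp add: X_def lookup_minus lookup_uminus add.commute algebra_simps)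
  have "vac_coeff (X m n vac) = (if m = - n then of_int (m ^ 3 - m) / 24 else 0)" for m n
  proof -
    consider "m \<ge> 2" "n \<le> - 2" | "n \<ge> 2" "m \<le> - 2" | "m \<ge> - 1" "n \<ge> - 1" | "m \<le> 1" "n \<le> 1" by linarith
    then show ?thesis
    proof cases
      case 1
      then show ?thesis by (rule X_vac)
    next
      case 2
      then have "vac_coeff (X m n vac) = - (if n = - m then of_int (n ^ 3 - n) / 24 else 0)"
        unfolding X_swap[of m n] lookup_uminus by (simp only: X_vac)
      then show ?thesis by (auto simp: power3_eq_cube field_simps)
    next
      case 3
      have "m = - n \<Longrightarrow> n = - 1 \<or> n = 0 \<or> n = 1" using 3 by auto
      then have z: "(if m = - n then of_int (m ^ 3 - m) / 24 else 0 :: complex) = 0" by auto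
      have "m = n \<or> m + n \<ge> - 1" using 3 by linarith
      then show ?thesis unfolding z using 3 by (auto simp: X_def L_vac)
    next
      case 4
      have "m = - n \<Longrightarrow> n = - 1 \<or> n = 0 \<or> n = 1" using 4 by auto
      then have z: "(if m = - n then of_int (m ^ 3 - m) / 24 else 0 :: complex) = 0" by auto
      have "m = n \<or> m + n \<le> 1" using 4 by linarith
      then show ?thesis unfolding z using 4 by (auto simp: X_def lookup_minus vac_coeff_L)
    qed
  qed
  then have "X m n u = fock_scale (if m = - n then of_int (m ^ 3 - m) / 24 else 0) u"
    using X_scalar by metis
  then show ?thesis by (auto simp: X_def algebra_simps)
qed

fun fock_gen :: "vir_gen \<Rightarrow> fock \<Rightarrow> fock" where
  "fock_gen (Lgen n) u = L n u"
| "fock_gen Cgen u = fock_scale (1/2) u"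

definition fock_act :: "virasoro \<Rightarrow> fock \<Rightarrow> fock" where
  "fock_act x u = (\<Sum>g\<in>Poly_Mapping.keys x. fock_scale (Poly_Mapping.lookup x g) (fock_gen g u))"

lemma fock_act_superset:
  assumes "finite S" "Poly_Mapping.keys x \<subseteq> S"
  shows "fock_act x u = (\<Sum>g\<in>S. fock_scale (Poly_Mapping.lookup x g) (fock_gen g u))"
  unfolding fock_act_def
  by (rule sum.mono_neutral_left) (use assms in \<open>auto simp: in_keys_iff\<close>)

lemma fock_act_add_left: "fock_act (x + y) u = fock_act x u + fock_act y u"
proof -
  let ?S = "Poly_Mapping.keys x \<union> Poly_Mapping.keys y"
  have "Poly_Mapping.keys (x + y) \<subseteq> ?S" by (rule Poly_Mapping.keys_add)
  then show ?thesis
    by (simp add: fock_act_superset[of ?S] lookup_add fock.scale_left_distrib sum.distrib)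
qed

lemma fock_act_scale_left: "fock_act (vir_scale a x) u = fock_scale a (fock_act x u)"
  using keys_vir_scale[of a x]
  by (simp add: fock_act_superset[of "Poly_Mapping.keys x"] fock.scale_sum_right)

lemma fock_act_L [simp]: "fock_act (vir_L n) u = L n u"
  by (simp add: fock_act_def vir_L_def)

lemma fock_act_C [simp]: "fock_act vir_C u = fock_scale (1/2) u"
  by (simp add: fock_act_def vir_C_def)

lemma fock_act_zero_left [simp]: "fock_act 0 u = 0"
  by (simp add: fock_act_def)

lemma fock_act_add: "fock_act x (u + v) = fock_act x u + fock_act x v"
proof -
  have "fock_gen g (u + v) = fock_gen g u + fock_gen g v" for g
    by (cases g) (simp_all add: L_add fock.scale_right_distrib)
  then show ?thesis by (simp add: fock_act_def fock.scale_right_distrib sum.distrib)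
qed

lemma fock_act_scale: "fock_act x (fock_scale a u) = fock_scale a (fock_act x u)"
proof -
  have "fock_gen g (fock_scale a u) = fock_scale a (fock_gen g u)" for g
    by (cases g) (simp_all add: L_scale)
  then show ?thesis by (simp add: fock_act_def fock.scale_sum_right mult.commute)
qed

lemma fock_act_bracket:
  "fock_act (vir_bracket x y) u = fock_act x (fock_act y u) - fock_act y (fock_act x u)"
proof (induction x rule: vir_induct)
  case (L m)
  show ?case
  proof (induction y rule: vir_induct)
    case (L n)
    show ?case
      by (auto simp: vir_bracket_L_L fock_act_add_left fock_act_scale_left L_L)
  next
    case C
    show ?case by (simp add: L_scale)
  qed (simp_all add: vir_bracket_bilinear fock_act_add_left fock_act_scale_left L_add L_scale
      fock.scale_right_diff_distrib)
next
  case C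
  show ?case
  proof (induction y rule: vir_induct)
    case (L n)
    show ?case by (simp add: L_scale)
  qed (simp_all add: vir_bracket_bilinear fock_act_add_left fock_act_scale_left
      fock.scale_right_diff_distrib fock.scale_right_distrib)
qed (simp_all add: vir_bracket_bilinear fock_act_add_left fock_act_scale_left fock_act_add fock_act_scale
      fock.scale_right_diff_distrib)

interpretation fock: virasoro_module fock_scale fock_act
  by unfold_locales (simp_all add: fock_act_add_left fock_act_scale_left fock_act_add fock_act_scale
      fock_act_bracket)

section \<open>A quadratic operator diagonal on the fermions\<close>

lemma L_eq_0: "annihilated_from K u \<Longrightarrow> 2 * K \<le> n + 1 \<Longrightarrow> L n u = 0"
proof -
  assume "annihilated_from K u" "2 * K \<le> n + 1"
  moreover from this(2) have "{(n + 1) div 2..<K} = {}" by auto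
  ultimately show ?thesis by (simp add: L_window)
qed

text \<open>
  The zero mode of the normally ordered square of the Virasoro field, up to lower terms. Being
  assembled from the \<open>L\<^sub>n\<close>, it preserves every Virasoro submodule.
\<close>

definition LL0 :: "fock \<Rightarrow> fock" where
  "LL0 u = L 0 (L 0 u) + (\<Sum>n | 0 < n \<and> L n u \<noteq> 0. fock_scale 2 (L (- n) (L n u)))"

lemma LL0_window:
  assumes "annihilated_from K u" "2 * K \<le> M + 2"
  shows "LL0 u = L 0 (L 0 u) + (\<Sum>n=1..M. fock_scale 2 (L (- n) (L n u)))"
proof -
  have "n \<le> M" if "L n u \<noteq> 0" for n
  proof (rule ccontr)
    assume "\<not> n \<le> M"
    then have "L n u = 0" using assms by (intro L_eq_0[of K]) auto
    then show False using that by simp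
  qed
  then show ?thesis unfolding LL0_def
    by (intro arg_cong2[where f="(+)"] refl sum.mono_neutral_left) auto
qed

lemma LL0_add: "LL0 (u + v) = LL0 u + LL0 v"
proof -
  obtain K1 K2 where K: "\<forall>K\<ge>K1. annihilated_from K u" "\<forall>K\<ge>K2. annihilated_from K v"
    using annihilated_from_ex by metis
  let ?K = "max K1 K2"
  have "annihilated_from ?K u" "annihilated_from ?K v" using K by simp_all
  then show ?thesis
    by (simp add: LL0_window[of ?K _ "2 * ?K"] annihilated_from_add L_add fock.scale_right_distrib
        sum.distrib algebra_simps)
qed

lemma LL0_scale: "LL0 (fock_scale a u) = fock_scale a (LL0 u)"
proof -
  obtain K where K: "annihilated_from K u" using annihilated_from_ex by blast
  then show ?thesis
    by (simp add: LL0_window[of K _ "2 * K"] annihilated_from_scale L_scale fock.scale_right_distrib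
        fock.scale_sum_right mult.commute)
qed

lemma LL0_zero [simp]: "LL0 0 = 0"
  by (simp add: LL0_def)

lemma LL0_sum: "LL0 (sum f S) = (\<Sum>x\<in>S. LL0 (f x))"
  by (induction S rule: infinite_finite_induct) (simp_all add: LL0_add)

lemma vac_coeff_LL0: "vac_coeff (LL0 u) = 0"
  unfolding LL0_def lookup_add lookup_sum by (simp add: vac_coeff_L)

lemma LL0_vac: "LL0 vac = 0"
  by (simp add: LL0_def L_vac)

text \<open>
  The half-odd number \<open>r = k + 1/2\<close> of the mode with index \<open>k\<close>.
\<close>

definition freq :: "int \<Rightarrow> complex" where
  "freq k = of_int (2 * k + 1) / 2"

definition LL0_comm :: "int \<Rightarrow> fock \<Rightarrow> fock" where
  "LL0_comm s u = LL0 (psi s u) - psi s (LL0 u)"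

lemma L_psi_freq: "L n (psi s u) = psi s (L n u) - fock_scale (freq s + of_int n / 2) (psi (s + n) u)"
  using L_psi[of n s u] by (simp add: freq_def add_divide_distrib add.commute)

text \<open>
  Minus one half of the commutator of \<open>LL0\<close> with \<open>psi s\<close>, up to a multiple of \<open>psi s\<close> (\<open>LL0_comm_eq\<close>). The sums are
  cut off at \<open>M\<close>, which has no effect on a given vector once \<open>M\<close> is large.
\<close>

definition LL0_half :: "int \<Rightarrow> int \<Rightarrow> fock \<Rightarrow> fock" where
  "LL0_half M s u = fock_scale (freq s) (psi s (L 0 u))
     + (\<Sum>n=1..M. fock_scale (freq s + of_int n / 2) (L (- n) (psi (s + n) u)))
     + (\<Sum>n=1..M. fock_scale (freq s - of_int n / 2) (psi (s - n) (L n u)))"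

lemma LL0_comm_eq:
  assumes "annihilated_from K u" "- 1 - s < K" "2 * K \<le> M + 2"
  shows "LL0_comm s u = fock_scale (freq s * freq s) (psi s u) - fock_scale 2 (LL0_half M s u)"
proof -
  have Ks: "annihilated_from K (psi s u)" using annihilated_from_psi[OF assms(1) order_refl assms(2)] .
  have step: "L (- n) (L n (psi s u)) = psi s (L (- n) (L n u))
      - fock_scale (freq s - of_int n / 2) (psi (s - n) (L n u))
      - fock_scale (freq s + of_int n / 2) (L (- n) (psi (s + n) u))" for n
    by (simp add: L_psi_freq[of n] L_diff L_scale L_psi_freq[of "- n" s])
  have step0: "L 0 (L 0 (psi s u)) = psi s (L 0 (L 0 u)) - fock_scale (freq s) (psi s (L 0 u))
      - fock_scale (freq s) (psi s (L 0 u) - fock_scale (freq s) (psi s u))"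
    by (simp add: L_psi_freq L_diff L_scale)
  show ?thesis
  proof (rule poly_mapping_eqI)
    fix A
    let ?l = "\<lambda>u::fock. Poly_Mapping.lookup u A"
    have "?l (LL0_comm s u) = freq s * freq s * ?l (psi s u) - 2 * (freq s * ?l (psi s (L 0 u)))
      - (\<Sum>n=1..M. 2 * ((freq s - of_int n / 2) * ?l (psi (s - n) (L n u))) +
           2 * ((freq s + of_int n / 2) * ?l (L (- n) (psi (s + n) u))))"
      unfolding LL0_comm_def LL0_window[OF assms(1,3)] LL0_window[OF Ks assms(3)]
        step step0 psi_add psi_sum psi_scale lookup_add lookup_minus lookup_sum lookup_fock_scale
      by (simp add: algebra_simps sum_subtractf sum.distrib)
    also have "\<dots> = ?l (fock_scale (freq s * freq s) (psi s u) - fock_scale 2 (LL0_half M s u))"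
      unfolding LL0_half_def lookup_add lookup_minus lookup_sum lookup_fock_scale
      by (simp add: algebra_simps sum.distrib sum_subtractf sum_distrib_left)
    finally show "?l (LL0_comm s u) =
        ?l (fock_scale (freq s * freq s) (psi s u) - fock_scale 2 (LL0_half M s u))" .
  qed
qed

text \<open>
  Here \<open>b m\<close> stands for a coefficient of \<open>\<psi>\<^sub>t\<^sub>-\<^sub>m \<psi>\<^sub>s\<^sub>+\<^sub>m\<close> with \<open>d = t - s\<close>. The reflection \<open>m \<mapsto> d - m\<close> exchanges the two
  fermions, so the anticommutation relations fold the sum onto its upper half, where the pairs are
  in the order used by \<open>L\<close>.
\<close>

lemma sum_reflect:
  fixes f b :: "int \<Rightarrow> complex"
  assumes b: "\<And>m. b (d - m) = e - b m" and mid: "\<And>m. 2 * m = d \<Longrightarrow> b m = 0"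
  shows "(\<Sum>m=1..<d. f m * b m) = (\<Sum>m | d < 2 * m \<and> m < d. (f m - f (d - m)) * b m)
    + (\<Sum>m | d < 2 * m \<and> m < d. f (d - m)) * e"
proof -
  let ?U = "{m. d < 2 * m \<and> m < d}" and ?D = "{m. 2 * m < d \<and> 0 < m}"
  have fin: "finite ?U" "finite ?D"
    by (rule finite_subset[of _ "{0..d}"]; auto)+
  have "(\<Sum>m=1..<d. f m * b m) = (\<Sum>m\<in>?U \<union> ?D. f m * b m)"
    by (rule sum.mono_neutral_right) (auto simp: mid not_less intro!: disjI2 mid)
  also have "\<dots> = (\<Sum>m\<in>?U. f m * b m) + (\<Sum>m\<in>?D. f m * b m)"
    by (rule sum.union_disjoint) (use fin in auto)
  also have "(\<Sum>m\<in>?D. f m * b m) = (\<Sum>m\<in>?U. f (d - m) * b (d - m))"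
    by (rule sum.reindex_bij_witness[of _ "\<lambda>m. d - m" "\<lambda>m. d - m"]) auto
  also have "\<dots> = (\<Sum>m\<in>?U. f (d - m)) * e - (\<Sum>m\<in>?U. f (d - m) * b m)"
    by (simp add: b right_diff_distrib sum_subtractf sum_distrib_right)
  finally show ?thesis by (simp add: left_diff_distrib sum_subtractf)
qed

text \<open>
  The cancellation of the quartic part of \<open>LL0\<close> is contained in this identity: the bilinears left over in
  the double commutator with \<open>\<psi>\<^sub>s\<close> and \<open>\<psi>\<^sub>t\<close> sum to a multiple of \<open>L\<^sub>s\<^sub>+\<^sub>t\<close>. In terms of the pairs \<open>b m\<close> the first sum has
  coefficients \<open>f m\<close>, and the second sum together with the last term has coefficients \<open>g m\<close> on \<open>m \<ge> d\<close>. The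
  pairs with \<open>0 < m < d\<close>, which only the first sum contains, are folded by \<open>sum_reflect\<close>, and since
  \<open>f (d - m) = g m\<close> the coefficient becomes \<open>f m - g m = d/2 (m - d/2)\<close> throughout.
\<close>

lemma bilinear_sum:
  assumes K: "annihilated_from K u" "K - s \<le> M" and st: "s \<le> t"
  defines "d \<equiv> t - s"
  shows "(\<Sum>n=1..M. fock_scale ((freq s + of_int n / 2) * (freq t - of_int n / 2)) (psi (t - n) (psi (s + n) u)))
    - (\<Sum>n=1..M. fock_scale ((freq s - of_int n / 2) * (freq t + of_int n / 2)) (psi (s - n) (psi (t + n) u)))
    - fock_scale (freq s * freq t) (psi s (psi t u))
    = fock_scale (of_int d / 2) (L (s + t + 1) u)
      - fock_scale (if s + t = - 1 then (\<Sum>m | d < 2 * m \<and> m < d. (of_int m)\<^sup>2) / 4 else 0) u"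
proof (rule poly_mapping_eqI)
  fix A
  let ?l = "\<lambda>u::fock. Poly_Mapping.lookup u A"
  define N where "N = s + t + 1"
  define b where "b m = ?l (psi (t - m) (psi (s + m) u))" for m
  define f where "f m = ((of_int N)\<^sup>2 - (of_int (m - d))\<^sup>2) / (4 :: complex)" for m
  define g where "g m = ((of_int N)\<^sup>2 - (of_int m)\<^sup>2) / (4 :: complex)" for m
  have b0: "b m = 0" if "m \<ge> M" for m
    using annihilated_fromD[OF K(1), of "s + m"] that K(2) by (simp add: b_def)
  have d0: "0 \<le> d" using st by (simp add: d_def)
  have f_eq: "(freq s + of_int m / 2) * (freq t - of_int m / 2) = f m" for m
    by (simp add: f_def freq_def N_def d_def power2_eq_square field_simps)
  have g_eq: "(freq s - of_int n / 2) * (freq t + of_int n / 2) = g (n + d)" for n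
    by (simp add: g_def freq_def N_def d_def power2_eq_square field_simps)
  have b_eq: "?l (psi (s - n) (psi (t + n) u)) = b (n + d)" for n
    by (simp add: b_def d_def algebra_simps)
  have bd: "freq s * freq t * ?l (psi s (psi t u)) = g d * b d"
    using g_eq[of 0] b_eq[of 0] by simp
  have "(\<Sum>n=1..M. g (n + d) * b (n + d)) + g d * b d = (\<Sum>n=0..M. g (n + d) * b (n + d))" if "0 \<le> M"
  proof -
    have "{0..M} = insert 0 {1..M}" using that by auto
    then show ?thesis by simp
  qed
  moreover have "(\<Sum>n=0..M. g (n + d) * b (n + d)) = (\<Sum>m=d..M + d. g m * b m)"
    by (rule sum.reindex_bij_witness[of _ "\<lambda>m. m - d" "\<lambda>m. m + d"]) auto
  moreover have "(\<Sum>m=d..M + d. g m * b m) = (\<Sum>m=d..M. g m * b m)"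
    by (rule sum.mono_neutral_right) (use d0 in \<open>auto simp: b0\<close>)
  moreover have "g d * b d = 0 \<and> {d..M} = {}" if "M < 0"
    using that d0 by (auto simp: b0)
  ultimately have second: "(\<Sum>n=1..M. g (n + d) * b (n + d)) + g d * b d = (\<Sum>m=d..M. g m * b m)"
    by (cases "0 \<le> M") auto
  have refl: "b (d - m) = (if s + t = - 1 then ?l u else 0) - b m" for m
  proof -
    have "t - (d - m) = s + m" "s + (d - m) = t - m" by (simp_all add: d_def)
    note idx = this
    show ?thesis unfolding b_def idx by (simp add: psi_swap[of "s + m"] lookup_minus)
  qed
  have mid: "b m = 0" if "2 * m = d" for m
  proof -
    have "t - m = s + m" using that by (simp add: d_def)
    then show ?thesis unfolding b_def by (simp only: psi_psi_same lookup_zero)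
  qed
  have fg: "f (d - m) = g m" for m by (simp add: f_def g_def)
  have fg_diff: "f m - g m = of_int d / 2 * (of_int m - of_int d / 2)" for m
    by (simp add: f_def g_def power2_eq_square field_simps)
  have zero: "f m - g m = 0" if "d = 0" for m using that by (simp add: f_def g_def)
  have first: "(\<Sum>m=1..M. f m * b m) - (\<Sum>m=d..M. g m * b m) =
      (\<Sum>m=1..<d. f m * b m) + (\<Sum>m=d..M. (f m - g m) * b m)"
  proof (cases "d = 0")
    case True
    have "b 0 = 0" using mid True by simp
    have "(\<Sum>m=d..M. g m * b m) = (\<Sum>m=1..M. g m * b m)"
      by (rule sum.mono_neutral_right) (use True \<open>b 0 = 0\<close> in \<open>auto simp: not_le\<close>, smt (verit))
    moreover have "f m = g m" for m using zero[OF True, of m] by simp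
    ultimately show ?thesis using True by simp
  next
    case False
    have "(\<Sum>m=1..M. f m * b m) = (\<Sum>m\<in>{1..<d} \<union> {d..M}. f m * b m)"
      by (rule sum.mono_neutral_left) (use False d0 in \<open>auto simp: b0\<close>)
    also have "\<dots> = (\<Sum>m=1..<d. f m * b m) + (\<Sum>m=d..M. f m * b m)"
      by (rule sum.union_disjoint) auto
    finally show ?thesis by (simp add: left_diff_distrib sum_subtractf)
  qed
  have fin: "finite {m. d < 2 * m \<and> m < d}"
    by (rule finite_subset[of _ "{0..d}"]) auto
  have "?l (L N u) = (\<Sum>k=(N + 1) div 2..<K. L_coeff N k * ?l (psi (N - k - 1) (psi k u)))"
    by (simp add: L_window[OF K(1)] lookup_sum)
  also have "\<dots> = (\<Sum>m | d < 2 * m \<and> m < K - s. (of_int m - of_int d / 2) * b m)"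
    by (rule sum.reindex_bij_witness[of _ "\<lambda>m. m + s" "\<lambda>k. k - s"])
      (auto simp: half_le_iff N_def d_def b_def L_coeff_def field_simps)
  also have "\<dots> = (\<Sum>m\<in>{m. d < 2 * m \<and> m < d} \<union> {m. d \<le> m \<and> d < 2 * m \<and> m \<le> M}. (of_int m - of_int d / 2) * b m)"
  proof (rule sum.mono_neutral_cong)
    show "finite {m. d < 2 * m \<and> m < K - s}"
      by (rule finite_subset[of _ "{d div 2..K - s}"]) auto
    have "finite {m. d \<le> m \<and> d < 2 * m \<and> m \<le> M}"
      by (rule finite_subset[of _ "{d..M}"]) auto
    then show "finite ({m. d < 2 * m \<and> m < d} \<union> {m. d \<le> m \<and> d < 2 * m \<and> m \<le> M})"
      using fin by simp
    have bK: "b m = 0" if "K - s \<le> m" for m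
      using annihilated_fromD[OF K(1), of "s + m"] that by (simp add: b_def)
    show "(of_int m - of_int d / 2) * b m = 0"
      if "m \<in> ({m. d < 2 * m \<and> m < d} \<union> {m. d \<le> m \<and> d < 2 * m \<and> m \<le> M}) - {m. d < 2 * m \<and> m < K - s}" for m
      using that by (auto simp: bK)
    show "(of_int m - of_int d / 2) * b m = 0"
      if "m \<in> {m. d < 2 * m \<and> m < K - s} - ({m. d < 2 * m \<and> m < d} \<union> {m. d \<le> m \<and> d < 2 * m \<and> m \<le> M})" for m
      using that K(2) by auto
  qed simp
  also have "\<dots> = (\<Sum>m | d < 2 * m \<and> m < d. (of_int m - of_int d / 2) * b m)
      + (\<Sum>m | d \<le> m \<and> d < 2 * m \<and> m \<le> M. (of_int m - of_int d / 2) * b m)"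
    by (rule sum.union_disjoint) (use fin in \<open>auto intro: finite_subset[of _ "{d..M}"]\<close>)
  also have "(\<Sum>m | d \<le> m \<and> d < 2 * m \<and> m \<le> M. (of_int m - of_int d / 2) * b m) =
      (\<Sum>m=d..M. (of_int m - of_int d / 2) * b m)"
  proof (rule sum.mono_neutral_left)
    have "m = 0 \<and> d = 0" if "d \<le> m" "\<not> d < 2 * m" for m using that d0 by linarith
    then show "\<forall>m\<in>{d..M} - {m. d \<le> m \<and> d < 2 * m \<and> m \<le> M}. (of_int m - of_int d / 2) * b m = 0"
      by force
  qed auto
  finally have LN: "?l (L N u) = (\<Sum>m | d < 2 * m \<and> m < d. (of_int m - of_int d / 2) * b m)
      + (\<Sum>m=d..M. (of_int m - of_int d / 2) * b m)" .
  have main: "(\<Sum>m=1..M. f m * b m) - (\<Sum>m=d..M. g m * b m) = of_int d / 2 * ?l (L N u)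
      + (\<Sum>m | d < 2 * m \<and> m < d. g m) * (if s + t = - 1 then ?l u else 0)"
  proof -
    have "(\<Sum>m=1..<d. f m * b m) = (\<Sum>m | d < 2 * m \<and> m < d. (f m - g m) * b m)
        + (\<Sum>m | d < 2 * m \<and> m < d. g m) * (if s + t = - 1 then ?l u else 0)"
      unfolding fg[symmetric] by (rule sum_reflect) (rule refl, erule mid)
    then show ?thesis unfolding first LN fg_diff
      by (simp add: distrib_left sum_distrib_left mult.assoc)
  qed
  have const: "(\<Sum>m | d < 2 * m \<and> m < d. g m) = - ((\<Sum>m | d < 2 * m \<and> m < d. (of_int m)\<^sup>2) / 4)" if "s + t = - 1"
    using that by (simp add: g_def N_def sum_negf sum_divide_distrib)
  show "?l ((\<Sum>n=1..M. fock_scale ((freq s + of_int n / 2) * (freq t - of_int n / 2)) (psi (t - n) (psi (s + n) u)))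
    - (\<Sum>n=1..M. fock_scale ((freq s - of_int n / 2) * (freq t + of_int n / 2)) (psi (s - n) (psi (t + n) u)))
    - fock_scale (freq s * freq t) (psi s (psi t u)))
    = ?l (fock_scale (of_int d / 2) (L (s + t + 1) u)
      - fock_scale (if s + t = - 1 then (\<Sum>m | d < 2 * m \<and> m < d. (of_int m)\<^sup>2) / 4 else 0) u)"
    unfolding lookup_minus lookup_sum lookup_fock_scale f_eq g_eq b_eq bd b_def[symmetric] N_def[symmetric]
    using main second const by (auto simp: algebra_simps)
qed

text \<open>
  Minus the eigenvalue by which \<open>LL0\<close> shifts under \<open>psi k\<close>. The constants are those of the closed form of the
  sum of squares in \<open>cubic_energy_eq\<close>.
\<close>

definition cubic_energy :: "int \<Rightarrow> complex" where
  "cubic_energy k = 7 / 6 * freq k ^ 3 + 5 / 24 * freq k"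

lemma cubic_energy_reflect: "cubic_energy (- 1 - k) = - cubic_energy k"
proof -
  have "freq (- 1 - k) = - freq k" by (simp add: freq_def field_simps)
  then show ?thesis by (simp add: cubic_energy_def power3_eq_cube)
qed

lemma cubic_energy_eq:
  "cubic_energy (int j) = freq (int j) * freq (int j) + (\<Sum>m | int (2 * j + 1) < 2 * m \<and> m < int (2 * j + 1). (of_int m)\<^sup>2) / 2"
proof -
  have set: "{m. int (2 * j + 1) < 2 * m \<and> m < int (2 * j + 1)} = int ` {j<..2 * j}"
  proof (intro equalityI subsetI)
    fix m assume "m \<in> {m. int (2 * j + 1) < 2 * m \<and> m < int (2 * j + 1)}"
    then show "m \<in> int ` {j<..2 * j}" by (intro image_eqI[of _ _ "nat m"]) auto
  qed auto
  have squares: "(\<Sum>m\<le>n. (of_nat m)\<^sup>2) = of_nat n * (of_nat n + 1) * (2 * of_nat n + 1) / (6 :: complex)" for n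
    by (induction n) (simp_all add: power2_eq_square field_simps)
  have "(\<Sum>m\<le>2 * j. (of_nat m)\<^sup>2) = (\<Sum>m\<le>j. (of_nat m)\<^sup>2) + (\<Sum>m\<in>{j<..2 * j}. (of_nat m)\<^sup>2 :: complex)"
  proof -
    have "{..2 * j} = {..j} \<union> {j<..2 * j}" by auto
    then show ?thesis by (simp only:) (rule sum.union_disjoint; auto)
  qed
  then have "(\<Sum>m\<in>{j<..2 * j}. (of_nat m)\<^sup>2 :: complex) =
      (\<Sum>m\<le>2 * j. (of_nat m)\<^sup>2) - (\<Sum>m\<le>j. (of_nat m)\<^sup>2)"
    by simp
  also have "\<dots> = of_nat j * (2 * of_nat j + 1) * (7 * of_nat j + 1) / 6"
    unfolding squares by (simp add: field_simps)
  finally have "(\<Sum>m\<in>{j<..2 * j}. (of_nat m)\<^sup>2 :: complex) =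
      of_nat j * (2 * of_nat j + 1) * (7 * of_nat j + 1) / 6" .
  moreover have "(\<Sum>m | int (2 * j + 1) < 2 * m \<and> m < int (2 * j + 1). (of_int m)\<^sup>2 :: complex) =
      (\<Sum>m\<in>{j<..2 * j}. (of_nat m)\<^sup>2)"
    unfolding set by (simp add: sum.reindex)
  ultimately have "(\<Sum>m | int (2 * j + 1) < 2 * m \<and> m < int (2 * j + 1). (of_int m)\<^sup>2 :: complex) =
      of_nat j * (2 * of_nat j + 1) * (7 * of_nat j + 1) / 6" by (simp only:)
  then show ?thesis
    by (simp only:) (simp add: cubic_energy_def freq_def power3_eq_cube field_simps)
qed

text \<open>
  The contractions in this anticommutator, one for each sign of \<open>s + t\<close>, add up to a multiple of
  \<open>L\<^sub>s\<^sub>+\<^sub>t\<close>, where \<open>s\<close> and \<open>t\<close> are read as modes. It is opposite to the multiple that \<open>bilinear_sum\<close> gives for the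
  uncontracted terms, so only a scalar survives.
\<close>

lemma LL0_half_anticomm:
  assumes st: "s \<le> t"
    and u: "annihilated_from K u" and M: "2 * K \<le> M + 2" "K - s \<le> M" "\<bar>s + t + 1\<bar> \<le> M"
  shows "LL0_half M s (psi t u) + psi t (LL0_half M s u) =
    - fock_scale (if s + t = - 1 then (\<Sum>m | t - s < 2 * m \<and> m < t - s. (of_int m)\<^sup>2) / 4 else 0) u"
proof -
  define N where "N = s + t + 1"
  have e1: "L (- n) (psi (s + n) (psi t u)) + psi t (L (- n) (psi (s + n) u)) =
      (if n = - N then L N u else 0) + fock_scale (freq t - of_int n / 2) (psi (t - n) (psi (s + n) u))" for n
  proof -
    have "psi t (L (- n) (psi (s + n) u)) = L (- n) (psi t (psi (s + n) u)) +
        fock_scale (freq t - of_int n / 2) (psi (t - n) (psi (s + n) u))"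
      by (simp add: L_psi_freq[of "- n" t])
    moreover have "psi t (psi (s + n) u) = (if n = - N then u else 0) - psi (s + n) (psi t u)"
      by (simp add: psi_swap[of t] N_def algebra_simps eq_neg_iff_add_eq_0) 
    ultimately show ?thesis by (simp add: L_diff)
  qed
  have e2: "psi (s - n) (L n (psi t u)) + psi t (psi (s - n) (L n u)) =
      (if n = N then L N u else 0) - fock_scale (freq t + of_int n / 2) (psi (s - n) (psi (t + n) u))" for n
  proof -
    have "t + (s - n) = - 1 \<longleftrightarrow> n = N" by (auto simp: N_def)
    then have "psi t (psi (s - n) (L n u)) = (if n = N then L n u else 0) - psi (s - n) (psi t (L n u))"
      by (simp only: psi_swap[of t])
    then show ?thesis by (simp add: L_psi_freq[of n t] psi_diff psi_scale)
  qed
  have e3: "psi s (L 0 (psi t u)) + psi t (psi s (L 0 u)) =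
      (if N = 0 then L N u else 0) - fock_scale (freq t) (psi s (psi t u))"
    using e2[of 0] by simp
  show ?thesis
  proof (rule poly_mapping_eqI)
    fix A
    let ?l = "\<lambda>u::fock. Poly_Mapping.lookup u A"
    have e1': "?l (L (- n) (psi (s + n) (psi t u))) + ?l (psi t (L (- n) (psi (s + n) u))) =
      (if n = - N then ?l (L N u) else 0) + (freq t - of_int n / 2) * ?l (psi (t - n) (psi (s + n) u))" for n
      using arg_cong[OF e1[of n], of ?l] by (simp add: lookup_add split: if_splits)
    have e2': "?l (psi (s - n) (L n (psi t u))) + ?l (psi t (psi (s - n) (L n u))) =
      (if n = N then ?l (L N u) else 0) - (freq t + of_int n / 2) * ?l (psi (s - n) (psi (t + n) u))" for n
      using arg_cong[OF e2[of n], of ?l] by (simp add: lookup_add lookup_minus split: if_splits)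
    have e3': "?l (psi s (L 0 (psi t u))) + ?l (psi t (psi s (L 0 u))) =
      (if N = 0 then ?l (L N u) else 0) - freq t * ?l (psi s (psi t u))"
      using arg_cong[OF e3, of ?l] by (simp add: lookup_add lookup_minus split: if_splits)
    have bil: "(\<Sum>n=1..M. (freq s + of_int n / 2) * (freq t - of_int n / 2) * ?l (psi (t - n) (psi (s + n) u)))
      - (\<Sum>n=1..M. (freq s - of_int n / 2) * (freq t + of_int n / 2) * ?l (psi (s - n) (psi (t + n) u)))
      - freq s * freq t * ?l (psi s (psi t u)) =
      of_int (t - s) / 2 * ?l (L N u)
      - (if s + t = - 1 then (\<Sum>m | t - s < 2 * m \<and> m < t - s. (of_int m)\<^sup>2) / 4 else 0) * ?l u"
      using arg_cong[OF bilinear_sum[OF u M(2) st], of ?l]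
      unfolding lookup_minus lookup_sum lookup_fock_scale N_def .
    have "freq s - of_int N / 2 = - (of_int (t - s) / 2)" by (simp add: freq_def N_def field_simps)
    then have deltas: "freq s * (if N = 0 then ?l (L N u) else 0)
      + (\<Sum>n=1..M. (freq s + of_int n / 2) * (if n = - N then ?l (L N u) else 0))
      + (\<Sum>n=1..M. (freq s - of_int n / 2) * (if n = N then ?l (L N u) else 0)) =
      - (of_int (t - s) / 2) * ?l (L N u)"
    proof -
      assume h: "freq s - of_int N / 2 = - (of_int (t - s) / 2)"
      have p: "(\<Sum>n=1..M. (freq s + of_int n / 2) * (if n = - N then ?l (L N u) else 0)) =
          (if N < 0 then (freq s - of_int N / 2) * ?l (L N u) else 0)"
      proof -
        have "(\<Sum>n=1..M. (freq s + of_int n / 2) * (if n = - N then ?l (L N u) else 0)) =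
            (\<Sum>n=1..M. if n = - N then (freq s - of_int N / 2) * ?l (L N u) else 0)"
          by (rule sum.cong) auto
        then show ?thesis using M(3) by (auto simp: N_def)
      qed
      have q: "(\<Sum>n=1..M. (freq s - of_int n / 2) * (if n = N then ?l (L N u) else 0)) =
          (if N > 0 then (freq s - of_int N / 2) * ?l (L N u) else 0)"
      proof -
        have "(\<Sum>n=1..M. (freq s - of_int n / 2) * (if n = N then ?l (L N u) else 0)) =
            (\<Sum>n=1..M. if n = N then (freq s - of_int N / 2) * ?l (L N u) else 0)"
          by (rule sum.cong) auto
        then show ?thesis using M(3) by (auto simp: N_def)
      qed
      show ?thesis unfolding p q h by (cases N "0 :: int" rule: linorder_cases) (use h in auto)
    qed
    have "?l (LL0_half M s (psi t u) + psi t (LL0_half M s u)) =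
      freq s * (?l (psi s (L 0 (psi t u))) + ?l (psi t (psi s (L 0 u))))
      + (\<Sum>n=1..M. (freq s + of_int n / 2) * (?l (L (- n) (psi (s + n) (psi t u))) + ?l (psi t (L (- n) (psi (s + n) u)))))
      + (\<Sum>n=1..M. (freq s - of_int n / 2) * (?l (psi (s - n) (L n (psi t u))) + ?l (psi t (psi (s - n) (L n u)))))"
      unfolding LL0_half_def psi_add psi_sum psi_scale lookup_add lookup_sum lookup_fock_scale
      by (simp add: distrib_left sum.distrib)
    also have "\<dots> = (freq s * (if N = 0 then ?l (L N u) else 0)
      + (\<Sum>n=1..M. (freq s + of_int n / 2) * (if n = - N then ?l (L N u) else 0))
      + (\<Sum>n=1..M. (freq s - of_int n / 2) * (if n = N then ?l (L N u) else 0)))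
      + ((\<Sum>n=1..M. (freq s + of_int n / 2) * (freq t - of_int n / 2) * ?l (psi (t - n) (psi (s + n) u)))
      - (\<Sum>n=1..M. (freq s - of_int n / 2) * (freq t + of_int n / 2) * ?l (psi (s - n) (psi (t + n) u)))
      - freq s * freq t * ?l (psi s (psi t u)))"
    proof -
      have plus: "(\<Sum>n=1..M. a n * (x n + c n * z n)) = (\<Sum>n=1..M. a n * x n) + (\<Sum>n=1..M. a n * c n * z n)"
        and minus: "(\<Sum>n=1..M. a n * (x n - c n * z n)) = (\<Sum>n=1..M. a n * x n) - (\<Sum>n=1..M. a n * c n * z n)"
        for a x c z :: "int \<Rightarrow> complex"
        by (simp_all add: distrib_left right_diff_distrib sum.distrib sum_subtractf mult.assoc)
      have single: "a * (x - c * z) = a * x - a * c * z" for a x c z :: complex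
        by (simp add: right_diff_distrib)
      have regroup: "a - c + (p + q) + (p' - q') = (a + p + p') + (q - q' - c)" for a c p q p' q' :: complex
        by simp
      show ?thesis unfolding e1' e2' e3' plus unfolding minus unfolding single by (rule regroup)
    qed
    also have "\<dots> = - ((if s + t = - 1 then (\<Sum>m | t - s < 2 * m \<and> m < t - s. (of_int m)\<^sup>2) / 4 else 0) * ?l u)"
      unfolding deltas bil by simp
    finally show "?l (LL0_half M s (psi t u) + psi t (LL0_half M s u)) =
      ?l (- fock_scale (if s + t = - 1 then (\<Sum>m | t - s < 2 * m \<and> m < t - s. (of_int m)\<^sup>2) / 4 else 0) u)"
      by (simp add: lookup_uminus)
  qed
qed

text \<open>
  For \<open>s \<le> t\<close> this is the previous computation. The case \<open>t < s\<close> reduces to it, because \<open>LL0\<close> commutes with the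
  scalar \<open>psi s (psi t u) + psi t (psi s u)\<close>, so the expression is antisymmetric in \<open>s\<close> and \<open>t\<close>.
\<close>

lemma LL0_comm_anticomm:
  "LL0_comm s (psi t u) + psi t (LL0_comm s u) = (if s + t = - 1 then - fock_scale (cubic_energy s) u else 0)"
proof -
  define E where "E s t = LL0_comm s (psi t u) + psi t (LL0_comm s u)" for s t
  have le: "E s t = (if s + t = - 1 then fock_scale (cubic_energy t) u else 0)" if st: "s \<le> t" for s t
  proof -
    obtain K0 where K0: "\<forall>K\<ge>K0. annihilated_from K u" using annihilated_from_ex by blast
    define K where "K = max K0 (\<bar>s\<bar> + \<bar>t\<bar> + 1)"
    define M where "M = 2 * K"
    have K_ge: "\<bar>s\<bar> + \<bar>t\<bar> + 1 \<le> K" by (simp add: K_def)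
    have K: "annihilated_from K u" "- 1 - s < K" "- 1 - t < K" using K0 by (auto simp: K_def)
    have Kt: "annihilated_from K (psi t u)" using annihilated_from_psi[OF K(1) order_refl K(3)] .
    have M: "2 * K \<le> M + 2" "K - s \<le> M" "\<bar>s + t + 1\<bar> \<le> M"
      using K_ge unfolding M_def by linarith+
    define S :: complex where "S = (\<Sum>m | t - s < 2 * m \<and> m < t - s. (of_int m)\<^sup>2)"
    have "E s t = fock_scale (freq s * freq s) (psi s (psi t u) + psi t (psi s u))
        - fock_scale 2 (LL0_half M s (psi t u) + psi t (LL0_half M s u))"
      unfolding E_def LL0_comm_eq[OF K(1,2) M(1)] LL0_comm_eq[OF Kt K(2) M(1)]
      by (simp add: psi_diff psi_scale fock.scale_right_distrib)
    also have "\<dots> = (if s + t = - 1 then fock_scale (freq s * freq s + S / 2) u else 0)"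
      unfolding LL0_half_anticomm[OF st K(1) M] psi_anticomm S_def[symmetric]
      by (auto simp: fock.scale_left_distrib)
    finally have "E s t = (if s + t = - 1 then fock_scale (freq s * freq s + S / 2) u else 0)" .
    moreover have "freq s * freq s + S / 2 = cubic_energy t" if "s + t = - 1"
    proof -
      have "0 \<le> t" using that st by linarith
      then obtain j where j: "t = int j" by (rule nonneg_int_cases)
      have s: "s = - 1 - int j" using that j by simp
      have ts: "t - s = int (2 * j + 1)" "freq s = - freq t" by (simp_all add: freq_def s j field_simps)
      have "S = (\<Sum>m | int (2 * j + 1) < 2 * m \<and> m < int (2 * j + 1). (of_int m)\<^sup>2)"
        unfolding S_def ts(1) ..
      then show ?thesis unfolding ts(2) j cubic_energy_eq by simp
    qed
    ultimately show ?thesis by auto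
  qed
  have swap: "E s t = - E t s" for s t
  proof -
    have "E s t + E t s = LL0 (psi s (psi t u) + psi t (psi s u))
        - (psi s (psi t (LL0 u)) + psi t (psi s (LL0 u)))"
      by (simp add: E_def LL0_comm_def LL0_add psi_diff)
    also have "\<dots> = 0" unfolding psi_anticomm by auto
    finally show ?thesis by (simp add: eq_neg_iff_add_eq_0)
  qed
  have refl: "cubic_energy t = - cubic_energy s" if "s + t = - 1" for s t
  proof -
    have "t = - 1 - s" using that by simp
    then show ?thesis by (simp add: cubic_energy_reflect)
  qed
  show ?thesis
  proof (cases "s \<le> t")
    case True
    then show ?thesis using le[OF True] refl[of s t] by (auto simp: E_def)
  next
    case False
    then have "E t s = (if t + s = - 1 then fock_scale (cubic_energy s) u else 0)" by (intro le) auto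
    then show ?thesis using swap[of s t] by (auto simp: E_def add.commute)
  qed
qed

text \<open>
  The difference of both sides anticommutes with every mode by the preceding lemma, and its vacuum
  coefficient on the vacuum is \<open>0\<close>; the only such operator is \<open>0\<close>.
\<close>

theorem LL0_psi: "LL0 (psi s u) = psi s (LL0 u) - fock_scale (cubic_energy s) (psi s u)"
proof -
  define Y where "Y u = LL0_comm s u + fock_scale (cubic_energy s) (psi s u)" for u
  have Yvac: "vac_coeff (Y vac) = 0"
    by (cases "s < 0") (simp_all add: Y_def LL0_comm_def LL0_vac lookup_add vac_coeff_LL0
        vac_coeff_psi psi_vac)
  have "Y u = fock_scale (vac_coeff (Y vac)) u"
  proof (rule fock_commutant[where \<sigma> = "- 1"])
    show "Y (u + v) = Y u + Y v" for u v
      by (simp add: Y_def LL0_comm_def LL0_add psi_add fock.scale_right_distrib)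
    show "Y (fock_scale a u) = fock_scale a (Y u)" for a u
      by (simp add: Y_def LL0_comm_def LL0_scale psi_scale fock.scale_right_distrib
          fock.scale_right_diff_distrib mult.commute)
    show "Y (psi t u) = fock_scale (- 1) (psi t (Y u))" for t u
    proof -
      have "Y (psi t u) + psi t (Y u) = (LL0_comm s (psi t u) + psi t (LL0_comm s u))
          + fock_scale (cubic_energy s) (psi s (psi t u) + psi t (psi s u))"
        by (simp add: Y_def psi_add psi_scale fock.scale_right_distrib)
      also have "\<dots> = 0" unfolding LL0_comm_anticomm psi_anticomm by simp
      finally show ?thesis by (simp add: eq_neg_iff_add_eq_0)
    qed
  qed (simp_all add: Yvac)
  then have "Y u = 0" unfolding Yvac by simp
  then show ?thesis by (simp add: Y_def LL0_comm_def algebra_simps)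
qed

section \<open>Irreducibility\<close>

text \<open>
  The Vandermonde argument: the component at \<open>y\<close> is eliminated by subtracting \<open>ev y\<close> times a power sum from
  the next one, which rescales the other components by nonzero factors.
\<close>

lemma (in vector_space) components_in_subspace:
  assumes W: "subspace W" and fin: "finite X" and inj: "inj_on ev X"
    and power: "\<And>j. (\<Sum>k\<in>X. scale (ev k ^ j) (w k)) \<in> W"
  shows "\<forall>k\<in>X. w k \<in> W"
  using fin inj power
proof (induction X arbitrary: w rule: finite_induct)
  case (insert y X)
  have "\<forall>k\<in>X. scale (ev k - ev y) (w k) \<in> W"
  proof (rule insert.IH)
    show "inj_on ev X" using insert.prems(1) by simp
    fix j
    have "(\<Sum>k\<in>insert y X. scale (ev k ^ Suc j) (w k)) - scale (ev y) (\<Sum>k\<in>insert y X. scale (ev k ^ j) (w k)) =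
        (\<Sum>k\<in>insert y X. scale (ev k ^ j) (scale (ev k - ev y) (w k)))"
      unfolding scale_sum_right sum_subtractf[symmetric]
      by (rule sum.cong) (simp_all add: scale_left_diff_distrib scale_right_diff_distrib mult.commute)
    also have "\<dots> = (\<Sum>k\<in>X. scale (ev k ^ j) (scale (ev k - ev y) (w k)))"
      using insert.hyps by simp
    finally have eq: "(\<Sum>k\<in>insert y X. scale (ev k ^ Suc j) (w k))
        - scale (ev y) (\<Sum>k\<in>insert y X. scale (ev k ^ j) (w k)) =
        (\<Sum>k\<in>X. scale (ev k ^ j) (scale (ev k - ev y) (w k)))" .
    show "(\<Sum>k\<in>X. scale (ev k ^ j) (scale (ev k - ev y) (w k))) \<in> W"
      unfolding eq[symmetric] by (intro subspace_diff[OF W] subspace_scale[OF W] insert.prems(2))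
  qed
  then have X: "\<forall>k\<in>X. w k \<in> W"
  proof (intro ballI)
    fix k assume k: "k \<in> X" and *: "\<forall>k\<in>X. scale (ev k - ev y) (w k) \<in> W"
    have "ev k \<noteq> ev y" using insert.prems(1) insert.hyps k by (auto simp: inj_on_def)
    then have "scale (inverse (ev k - ev y)) (scale (ev k - ev y) (w k)) = w k" by simp
    then show "w k \<in> W" using subspace_scale[OF W, of "scale (ev k - ev y) (w k)" "inverse (ev k - ev y)"] * k
      by simp
  qed
  have "w y + (\<Sum>k\<in>X. w k) \<in> W" using insert.prems(2)[of 0] insert.hyps by simp
  then have "w y + (\<Sum>k\<in>X. w k) - (\<Sum>k\<in>X. w k) \<in> W"
    using X by (intro subspace_diff[OF W] subspace_sum[OF W]) auto
  then show ?case using X by simp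
qed simp

lemma annihilated_from_LL0: "annihilated_from K u \<Longrightarrow> annihilated_from K (LL0 u)"
  unfolding annihilated_from_def
proof (intro allI impI)
  fix k assume "\<forall>k\<ge>K. psi k u = 0" "K \<le> k"
  then have "psi k u = 0" by simp
  then show "psi k (LL0 u) = 0" using LL0_psi[of k u] by simp
qed

lemma LL0_submodule:
  assumes "fock.submodule W" "u \<in> W"
  shows "LL0 u \<in> W"
proof -
  have L: "L n v \<in> W" if "v \<in> W" for n v
  proof -
    have "fock_act (vir_L n) v \<in> W" using assms(1) that unfolding fock.submodule_def by blast
    then show ?thesis by simp
  qed
  have "fock.subspace W" using assms(1) by (simp add: fock.submodule_def)
  then show ?thesis unfolding LL0_def
    by (intro fock.subspace_add fock.subspace_sum fock.subspace_scale L assms(2))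
qed

lemma LL0_psi_psi: "LL0 (psi a (psi b u)) =
    psi a (psi b (LL0 u)) - fock_scale (cubic_energy a + cubic_energy b) (psi a (psi b u))"
  by (simp add: LL0_psi psi_diff psi_scale fock.scale_left_distrib)

text \<open>
  With \<open>a = N/2 - x\<close> and \<open>b = N/2 + x\<close> the sum \<open>a\<^sup>3 + b\<^sup>3\<close> is \<open>N\<^sup>3/4 + 3 N x\<^sup>2\<close>, which determines \<open>x > 0\<close> when \<open>N \<noteq> 0\<close>. Below,
  \<open>x j\<close> is twice this number.
\<close>

lemma cubic_energy_pair_inj:
  assumes N: "N \<noteq> 0" and k: "N \<le> 2 * k" "N \<le> 2 * k'"
    and eq: "cubic_energy (N - k - 1) + cubic_energy k = cubic_energy (N - k' - 1) + cubic_energy k'"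
  shows "k = k'"
proof -
  define x :: "int \<Rightarrow> int" where "x j = 2 * j + 1 - N" for j
  have sum: "cubic_energy (N - j - 1) + cubic_energy j =
      7 / 24 * of_int N ^ 3 + 7 / 8 * of_int N * (of_int (x j))\<^sup>2 + 5 / 24 * of_int N" for j
    by (simp add: cubic_energy_def freq_def x_def power2_eq_square power3_eq_cube field_simps)
  have "complex_of_int ((x k)\<^sup>2) = of_int ((x k')\<^sup>2)" using eq N unfolding sum by simp
  then have "(x k)\<^sup>2 = (x k')\<^sup>2" by (simp only: of_int_eq_iff)
  moreover have "x k > 0" "x k' > 0" using k by (simp_all add: x_def)
  ultimately have "x k = x k'" by (simp add: power2_eq_iff)
  then show ?thesis by (simp add: x_def)
qed

text \<open>
  The terms of \<open>L\<^sub>N\<close> are eigenvectors of the commutator with \<open>LL0\<close>, with distinct eigenvalues for \<open>N \<noteq> 0\<close>. Iterated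
  commutators with \<open>LL0\<close> preserve \<open>W\<close>, so \<open>components_in_subspace\<close> puts each term separately into \<open>W\<close>.
\<close>

theorem submodule_psi_psi:
  assumes W: "fock.submodule W" and u: "u \<in> W" and ab: "a + b \<noteq> - 1"
  shows "psi a (psi b u) \<in> W"
proof -
  have sub: "fock.subspace W" using W by (simp add: fock.submodule_def)
  have less: "psi a (psi b u) \<in> W" if ab: "a + b \<noteq> - 1" "a < b" for a b
  proof -
    define N where "N = a + b + 1"
    have "N \<noteq> 0" using ab(1) by (simp add: N_def)
    obtain K where K: "annihilated_from K u" using annihilated_from_ex by blast
    let ?X = "{(N + 1) div 2..<K}"
    define mu where "mu k = cubic_energy (N - k - 1) + cubic_energy k" for k
    define w where "w v k = fock_scale (L_coeff N k) (psi (N - k - 1) (psi k v))" for v k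
    \<comment> \<open>One cutoff \<open>K\<close> serves all iterated commutators, since \<open>LL0\<close> preserves the condition on \<open>v\<close>.\<close>
    have "(\<Sum>k\<in>?X. fock_scale (mu k ^ j) (w v k)) \<in> W" if "v \<in> W" "annihilated_from K v" for j v
      using that
    proof (induction j arbitrary: v)
      case 0
      have "fock_act (vir_L N) v \<in> W" using W 0(1) unfolding fock.submodule_def by blast
      then show ?case using L_window[OF 0(2), of N] by (simp add: w_def)
    next
      case (Suc j)
      have cas: "LL0 (w v k) = w (LL0 v) k - fock_scale (mu k) (w v k)" for k
        by (simp add: w_def LL0_scale LL0_psi_psi mu_def fock.scale_right_diff_distrib mult.commute)
      have eq: "(\<Sum>k\<in>?X. fock_scale (mu k ^ Suc j) (w v k)) =
          (\<Sum>k\<in>?X. fock_scale (mu k ^ j) (w (LL0 v) k)) - LL0 (\<Sum>k\<in>?X. fock_scale (mu k ^ j) (w v k))"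
        unfolding LL0_sum LL0_scale cas sum_subtractf[symmetric]
        by (rule sum.cong, simp, simp only: fock.scale_right_diff_distrib fock.scale_scale power_Suc2) simp
      show ?case unfolding eq
        using Suc by (intro fock.subspace_diff[OF sub] LL0_submodule[OF W] Suc.IH annihilated_from_LL0)
    qed
    from this[OF u K] have comp: "\<forall>k\<in>?X. w u k \<in> W"
    proof (intro fock.components_in_subspace[OF sub, of ?X mu])
      show "inj_on mu ?X"
        by (auto intro!: inj_onI cubic_energy_pair_inj[of N, OF \<open>N \<noteq> 0\<close>] simp: half_le_iff mu_def)
    qed auto
    show ?thesis
    proof (cases "b < K")
      case True
      then have "w u b \<in> W" using comp ab(2) by (auto simp: half_le_iff N_def)
      moreover have "L_coeff N b \<noteq> 0"
      proof -
        have "2 * b + 1 - N \<noteq> 0" using ab(2) by (simp add: N_def)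
        then show ?thesis unfolding L_coeff_def by (metis divide_eq_0_iff of_int_eq_0_iff zero_neq_numeral)
      qed
      moreover have "N - b - 1 = a" by (simp add: N_def)
      ultimately have "fock_scale (inverse (L_coeff N b)) (w u b) = psi a (psi b u)"
        by (simp add: w_def)
      then show ?thesis using fock.subspace_scale[OF sub \<open>w u b \<in> W\<close>, of "inverse (L_coeff N b)"] by simp
    next
      case False
      then show ?thesis using annihilated_fromD[OF K, of b] fock.subspace_0[OF sub] by simp
    qed
  qed
  consider "a < b" | "a = b" | "b < a" by linarith
  then show ?thesis
  proof cases
    case 3
    then have "psi b (psi a u) \<in> W" using ab by (intro less) (simp_all add: add.commute)
    then have "fock_scale (- 1) (psi b (psi a u)) \<in> W" by (rule fock.subspace_scale[OF sub])
    then show ?thesis using ab by (simp add: psi_swap[of a b])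
  qed (use less ab psi_psi_same fock.subspace_0[OF sub] in auto)
qed

lemma card_fset_eq_0_iff: "card (fset A) = 0 \<longleftrightarrow> A = {||}"
  by (metis bot_fset.rep_eq card_0_eq finite_fset fset_inject)

definition fock_parity :: "bool \<Rightarrow> fock set" where
  "fock_parity p = {u. \<forall>A\<in>Poly_Mapping.keys u. even (card (fset A)) = p}"

text \<open>
  The ground states: the vacuum, of weight \<open>0\<close>, and the state with one fermion of energy \<open>1/2\<close>.
\<close>

definition ground :: "bool \<Rightarrow> fock" where
  "ground p = (if p then vac else psi (- 1) vac)"

lemma even_card_flip: "even (card (fset (flip m A))) \<longleftrightarrow> odd (card (fset A))"
proof (cases "m |\<in>| A")
  case True
  then have "card (fset A) = Suc (card (fset A - {m}))" by (intro card.remove) auto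
  moreover have "fset (flip m A) = fset A - {m}" using True by (simp add: flip_def)
  ultimately show ?thesis by (simp only: even_Suc simp_thms)
qed (simp add: flip_def)

lemma subspace_fock_parity: "fock.subspace (fock_parity p)"
proof (rule fock.subspaceI)
  show "u + v \<in> fock_parity p" if "u \<in> fock_parity p" "v \<in> fock_parity p" for u v
    using that keys_add[of u v] by (auto simp: fock_parity_def)
qed (auto simp: fock_parity_def in_keys_iff)

lemma psi_parity: "u \<in> fock_parity p \<Longrightarrow> psi k u \<in> fock_parity (\<not> p)"
  unfolding fock_parity_def
proof (intro CollectI ballI)
  fix A assume u: "u \<in> {u. \<forall>A\<in>Poly_Mapping.keys u. even (card (fset A)) = p}"
    and "A \<in> Poly_Mapping.keys (psi k u)"
  then have "flip (mode k) A \<in> Poly_Mapping.keys u"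
    by (auto simp: in_keys_iff lookup_psi split: if_splits)
  then show "even (card (fset A)) = (\<not> p)" using u even_card_flip[of "mode k" A] by auto
qed

lemma submodule_fock_parity: "fock.submodule (fock_parity p)"
proof (rule fock.submoduleI[OF subspace_fock_parity])
  fix n u assume u: "u \<in> fock_parity p"
  have "psi a (psi b u) \<in> fock_parity p" for a b
    using psi_parity[OF psi_parity[OF u], of a b] by simp
  then show "fock_act (vir_L n) u \<in> fock_parity p"
    by (simp add: L_def fock.subspace_sum[OF subspace_fock_parity] fock.subspace_scale[OF subspace_fock_parity])
qed (simp add: fock.subspace_scale[OF subspace_fock_parity])

lemma vac_parity: "vac \<in> fock_parity True"
  by (simp add: fock_parity_def vac_def)

lemma ground_parity: "ground p \<in> fock_parity p"
  using vac_parity psi_parity[OF vac_parity] by (cases p) (simp_all add: ground_def)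

lemma psi_neg_one_vac: "psi (- 1) vac = Poly_Mapping.single {|0|} 1"
  using psi_single[of 0 "{||}"] by (simp add: vac_def fermi_sign_def)

text \<open>
  Particles are created in pairs. A single particle in state \<open>m \<noteq> 0\<close> is obtained from the odd ground state
  by annihilating the particle in state \<open>0\<close> and creating \<open>m\<close>.
\<close>

lemma submodule_ground_imp_single:
  assumes W: "fock.submodule W" and g: "ground p \<in> W"
  shows "even (card (fset A)) = p \<Longrightarrow> Poly_Mapping.single A 1 \<in> W"
proof (induction "card (fset A)" arbitrary: A rule: less_induct)
  case less
  have sub: "fock.subspace W" using W by (simp add: fock.submodule_def)
  have create: "Poly_Mapping.single (finsert a B) 1 \<in> W"
    if "psi (- int a - 1) (Poly_Mapping.single B 1) \<in> W" "a |\<notin>| B" for a B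
  proof -
    have "fock_scale (fermi_sign a B) (psi (- int a - 1) (Poly_Mapping.single B 1)) \<in> W"
      by (rule fock.subspace_scale[OF sub that(1)])
    then show ?thesis by (simp add: psi_single[OF that(2)] fermi_sign_square)
  qed
  consider "card (fset A) = 0" | "card (fset A) = 1" | "card (fset A) \<ge> 2" by linarith
  then show ?case
  proof cases
    case 1
    then have "A = {||}" by (simp only: card_fset_eq_0_iff) 
    moreover from this have p using less.prems by simp
    ultimately show ?thesis using g by (simp add: ground_def vac_def)
  next
    case 2
    then obtain m where m: "fset A = {m}" by (meson card_1_singletonE)
    then have A: "A = {|m|}" by (metis bot_fset.rep_eq finsert.rep_eq fset_inverse)
    have "\<not> p" using less.prems 2 by simp
    show ?thesis
    proof (cases "m = 0")
      case True
      then show ?thesis using g \<open>\<not> p\<close> A by (simp add: ground_def psi_neg_one_vac)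
    next
      case False
      have "psi (- int m - 1) (psi 0 (ground p)) \<in> W"
        using False by (intro submodule_psi_psi[OF W g]) auto
      also have "psi 0 (ground p) = vac"
        using \<open>\<not> p\<close> by (simp add: ground_def psi_swap[of 0] psi_vac)
      finally show ?thesis using create[of m "{||}"] by (simp add: vac_def A)
    qed
  next
    case 3
    then obtain a where a: "a |\<in>| A" by (metis card.empty equals0I not_numeral_le_zero)
    have "card (fset A - {a}) \<ge> 1" using 3 a by (simp add: card_Diff_singleton)
    then obtain b where b: "b \<in> fset A - {a}" by (metis card.empty equals0I not_one_le_zero)
    define B where "B = A |-| {|a|} |-| {|b|}"
    have A: "A = finsert a (finsert b B)" "b |\<notin>| B" "a |\<notin>| finsert b B"
      using a b by (auto simp: B_def)
    then have card: "card (fset A) = card (fset B) + 2" by simp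
    have "Poly_Mapping.single B 1 \<in> W" using less.prems card by (intro less.hyps) auto
    then have "psi (- int a - 1) (psi (- int b - 1) (Poly_Mapping.single B 1)) \<in> W"
      by (intro submodule_psi_psi[OF W]) auto
    then have "fock_scale (fermi_sign b B) (psi (- int a - 1) (psi (- int b - 1) (Poly_Mapping.single B 1))) \<in> W"
      by (rule fock.subspace_scale[OF sub])
    then have "psi (- int a - 1) (Poly_Mapping.single (finsert b B) 1) \<in> W"
      by (simp add: psi_single[OF A(2)] psi_scale fermi_sign_square)
    then show ?thesis unfolding A(1) by (rule create) (rule A(3))
  qed
qed

lemma fock_expansion:
  "u = (\<Sum>A\<in>Poly_Mapping.keys u. fock_scale (Poly_Mapping.lookup u A) (Poly_Mapping.single A 1))"
  by (rule poly_mapping_eqI) (simp add: lookup_sum lookup_single when_def if_distrib[of "(*) c" for c] in_keys_iff cong: if_cong)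

lemma submodule_ground_imp_parity:
  assumes W: "fock.submodule W" and g: "ground p \<in> W"
  shows "fock_parity p \<subseteq> W"
proof
  fix u assume u: "u \<in> fock_parity p"
  have sub: "fock.subspace W" using W by (simp add: fock.submodule_def)
  have "(\<Sum>A\<in>Poly_Mapping.keys u. fock_scale (Poly_Mapping.lookup u A) (Poly_Mapping.single A 1)) \<in> W"
    using u submodule_ground_imp_single[OF W g]
    by (intro fock.subspace_sum[OF sub] fock.subspace_scale[OF sub]) (auto simp: fock_parity_def)
  then show "u \<in> W" using fock_expansion by metis
qed

lemma lookup_psi_annihilate:
  "Poly_Mapping.lookup (psi (int m) u) A =
    (if m |\<in>| A then 0 else fermi_sign m A * Poly_Mapping.lookup u (finsert m A))"
  by (auto simp: lookup_psi mode_def flip_def)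

lemma fermi_sign_nonzero: "fermi_sign m A \<noteq> 0"
  using fermi_sign_square[of m A] by auto

text \<open>
  A basis vector with at least two particles in the support of \<open>u\<close> stays visible after annihilating two of
  them, while the maximal number of particles drops by \<open>2\<close>. This ends with a multiple of the vacuum, or
  with one-particle states.
\<close>

lemma submodule_contains_ground:
  assumes W: "fock.submodule W"
  shows "u \<in> W \<Longrightarrow> u \<in> fock_parity p \<Longrightarrow> u \<noteq> 0 \<Longrightarrow> \<forall>A\<in>Poly_Mapping.keys u. card (fset A) \<le> n \<Longrightarrow> ground p \<in> W"
proof (induction n arbitrary: u rule: less_induct)
  case (less n)
  have sub: "fock.subspace W" using W by (simp add: fock.submodule_def)
  have normalize: "v \<in> W" if "fock_scale c v \<in> W" "c \<noteq> 0" for c v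
    using fock.subspace_scale[OF sub that(1), of "inverse c"] that(2) by simp
  show ?case
  proof (cases "\<exists>A\<in>Poly_Mapping.keys u. card (fset A) \<ge> 2")
    case True
    then obtain A where A: "A \<in> Poly_Mapping.keys u" "card (fset A) \<ge> 2" by blast
    then obtain a where a: "a |\<in>| A" by (metis card.empty equals0I not_numeral_le_zero)
    have "card (fset A - {a}) \<ge> 1" using A a by (simp add: card_Diff_singleton)
    then obtain b where b: "b \<in> fset A - {a}" by (metis card.empty equals0I not_one_le_zero)
    let ?v = "psi (int a) (psi (int b) u)"
    have look: "Poly_Mapping.lookup ?v B = (if a |\<in>| B \<or> b |\<in>| finsert a B then 0 else
        fermi_sign a B * fermi_sign b (finsert a B) * Poly_Mapping.lookup u (finsert b (finsert a B)))" for B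
      by (auto simp: lookup_psi_annihilate)
    show ?thesis
    proof (rule less.IH[of "n - 2" ?v])
      show "n - 2 < n" using less.prems(4) A by force
      show "?v \<in> W" by (rule submodule_psi_psi[OF W less.prems(1)]) auto
      show "?v \<in> fock_parity p" using psi_parity[OF psi_parity[OF less.prems(2)]] by simp
      define B where "B = A |-| {|a|} |-| {|b|}"
      have B: "A = finsert b (finsert a B)" "b |\<notin>| finsert a B" "a |\<notin>| B"
        using a b by (auto simp: B_def)
      have "Poly_Mapping.lookup ?v B \<noteq> 0"
        unfolding look using B A(1) by (simp add: fermi_sign_nonzero in_keys_iff)
      then show "?v \<noteq> 0" by auto
      show "\<forall>B\<in>Poly_Mapping.keys ?v. card (fset B) \<le> n - 2"
      proof
        fix B assume "B \<in> Poly_Mapping.keys ?v"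
        then have B: "a |\<notin>| B" "b |\<notin>| finsert a B" "finsert b (finsert a B) \<in> Poly_Mapping.keys u"
          by (auto simp: in_keys_iff look split: if_splits)
        then have "card (fset (finsert b (finsert a B))) \<le> n" using less.prems(4) by blast
        then show "card (fset B) \<le> n - 2" using B by simp
      qed
    qed
  next
    case False
    then have le1: "card (fset A) \<le> 1" if "A \<in> Poly_Mapping.keys u" for A using that by force
    have "Poly_Mapping.keys u \<noteq> {}" using less.prems(3) by simp
    then obtain A where A: "A \<in> Poly_Mapping.keys u" by blast
    show ?thesis
    proof (cases p)
      case True
      have "B = {||}" if "B \<in> Poly_Mapping.keys u" for B
      proof -
        have "even (card (fset B))" "card (fset B) \<le> 1"
          using less.prems(2) that True le1 by (auto simp: fock_parity_def)
        then have "card (fset B) = 0" by (metis One_nat_def le_Suc_eq le_zero_eq odd_one)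
        then show ?thesis by (simp only: card_fset_eq_0_iff)
      qed
      then have "u = fock_scale (vac_coeff u) vac"
        by (intro poly_mapping_eqI) (auto simp: vac_def lookup_single when_def in_keys_iff)
      moreover from this have "vac_coeff u \<noteq> 0" using less.prems(3) by auto
      ultimately show ?thesis using normalize less.prems(1) True by (metis ground_def)
    next
      case False
      have single: "\<exists>m. B = {|m|}" if "B \<in> Poly_Mapping.keys u" for B
      proof -
        have "odd (card (fset B))" "card (fset B) \<le> 1"
          using less.prems(2) that False le1 by (auto simp: fock_parity_def)
        then have "card (fset B) = 1" by (metis One_nat_def le_Suc_eq le_zero_eq even_zero)
        then obtain m where "fset B = {m}" by (meson card_1_singletonE)
        then show ?thesis by (metis bot_fset.rep_eq finsert.rep_eq fset_inverse)
      qed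
      then obtain m where m: "{|m|} \<in> Poly_Mapping.keys u" using A by blast
      define c where "c = vac_coeff (psi (int m) u)"
      have c: "c \<noteq> 0" using m by (simp add: c_def lookup_psi_annihilate in_keys_iff fermi_sign_nonzero)
      have mu: "psi (int m) u = fock_scale c vac"
      proof (rule poly_mapping_eqI)
        fix B
        have "finsert m B \<notin> Poly_Mapping.keys u" if "B \<noteq> {||}" "m |\<notin>| B"
          using single[of "finsert m B"] that by (metis finsertI1 finsert_iff fsingleton_iff all_not_fin_conv)
        then show "Poly_Mapping.lookup (psi (int m) u) B = Poly_Mapping.lookup (fock_scale c vac) B"
          by (cases "B = {||}") (auto simp: c_def vac_def lookup_single when_def lookup_psi_annihilate in_keys_iff)
      qed
      \<comment> \<open>The product of \<open>psi (- 1)\<close> and \<open>psi 0\<close> is not available, because its modes add up to \<open>0\<close>; for \<open>m = 0\<close> the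
        particle is moved to state \<open>1\<close> and back.\<close>
      have "psi (- 1) vac \<in> W"
      proof (cases "m = 0")
        case False
        then have "psi (- 1) (psi (int m) u) \<in> W" by (intro submodule_psi_psi[OF W less.prems(1)]) auto
        then show ?thesis using normalize[OF _ c] by (simp add: mu psi_scale)
      next
        case True
        have "psi (- 2) (psi (int m) u) \<in> W" using True by (intro submodule_psi_psi[OF W less.prems(1)]) auto
        then have "psi (- 2) vac \<in> W" using normalize[OF _ c] by (simp add: mu psi_scale)
        then have "psi (- 1) (psi 1 (psi (- 2) vac)) \<in> W" by (intro submodule_psi_psi[OF W]) auto
        then show ?thesis by (simp add: psi_swap[of 1] psi_vac)
      qed
      then show ?thesis using False by (simp add: ground_def)
    qed
  qed
qed

theorem fock_parity_irreducible:
  assumes W: "fock.submodule W" "W \<subseteq> fock_parity p"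
  shows "W = {0} \<or> W = fock_parity p"
proof (cases "W = {0}")
  case False
  have "0 \<in> W" using W(1) fock.subspace_0 by (auto simp: fock.submodule_def)
  then obtain u where u: "u \<in> W" "u \<noteq> 0" using False by blast
  obtain n where "\<forall>A\<in>Poly_Mapping.keys u. card (fset A) \<le> n"
    using finite_nat_set_iff_bounded_le[of "(\<lambda>A. card (fset A)) ` Poly_Mapping.keys u"] by auto
  then have "ground p \<in> W" using submodule_contains_ground[OF W(1) u(1) _ u(2)] W(2) u(1) by blast
  then show ?thesis using submodule_ground_imp_parity[OF W(1)] W(2) by blast
qed simp

section \<open>Weight spaces of the Fock space\<close>

definition fock_weight :: "nat fset \<Rightarrow> nat" where
  "fock_weight A = (\<Sum>i\<in>fset A. 2 * i + 1)"

lemma even_fock_weight: "even (fock_weight A) \<longleftrightarrow> even (card (fset A))"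
  unfolding fock_weight_def sum.distrib sum_distrib_left[symmetric] by simp

text \<open>
  The summand of \<open>L\<^sub>0\<close> at \<open>k \<ge> 0\<close> contributes the energy \<open>k + 1/2\<close> if the state \<open>k\<close> is occupied.
\<close>

lemma lookup_L_0: "Poly_Mapping.lookup (L 0 u) A = of_nat (fock_weight A) / 2 * Poly_Mapping.lookup u A"
proof -
  obtain K0 where K0: "\<forall>K\<ge>K0. annihilated_from K u" using annihilated_from_ex by blast
  obtain M where M: "\<forall>i\<in>fset A. i < M" using finite_nat_set_iff_bounded[of "fset A"] by auto
  define K where "K = max K0 (int M)"
  have K: "annihilated_from K u" using K0 by (simp add: K_def)
  have number: "Poly_Mapping.lookup (psi (- k - 1) (psi k u)) A =
      (if nat k |\<in>| A then Poly_Mapping.lookup u A else 0)" if "0 \<le> k" for k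
    using that
    by (auto simp: lookup_psi mode_def mem_flip fermi_sign_flip fermi_sign_square mult.assoc[symmetric])
  have "Poly_Mapping.lookup (L 0 u) A =
      (\<Sum>k=0..<K. L_coeff 0 k * Poly_Mapping.lookup (psi (0 - k - 1) (psi k u)) A)"
    by (simp add: L_window[OF K] lookup_sum)
  also have "\<dots> = (\<Sum>m<nat K. L_coeff 0 (int m) * (if m |\<in>| A then Poly_Mapping.lookup u A else 0))"
    by (rule sum.reindex_bij_witness[of _ int nat]) (auto simp: number)
  also have "\<dots> = (\<Sum>m\<in>fset A. L_coeff 0 (int m) * Poly_Mapping.lookup u A)"
    by (rule sum.mono_neutral_cong_right) (use M in \<open>auto simp: K_def\<close>)
  also have "\<dots> = of_nat (fock_weight A) / 2 * Poly_Mapping.lookup u A"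
    by (simp add: fock_weight_def sum_distrib_right[symmetric] L_coeff_def sum_divide_distrib[symmetric] add.commute)
  finally show ?thesis .
qed

lemma weight_space_fock:
  assumes "even k = p"
  shows "fock.weight_space (of_nat k / 2) \<inter> fock_parity p = {u :: fock. \<forall>A\<in>Poly_Mapping.keys u. fock_weight A = k}"
proof (intro equalityI subsetI)
  fix u assume u: "u \<in> fock.weight_space (of_nat k / 2) \<inter> fock_parity p"
  then have L0: "L 0 u = fock_scale (of_nat k / 2) u" by (simp add: fock.weight_space_def)
  show "u \<in> {u :: fock. \<forall>A\<in>Poly_Mapping.keys u. fock_weight A = k}"
  proof (intro CollectI ballI)
    fix A assume "A \<in> Poly_Mapping.keys u"
    then show "fock_weight A = k" using lookup_L_0[of u A] L0 by (simp add: in_keys_iff)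
  qed
next
  fix u assume u: "u \<in> {u :: fock. \<forall>A\<in>Poly_Mapping.keys u. fock_weight A = k}"
  have "L 0 u = fock_scale (of_nat k / 2) u"
  proof (rule poly_mapping_eqI)
    fix A
    show "Poly_Mapping.lookup (L 0 u) A = Poly_Mapping.lookup (fock_scale (of_nat k / 2) u) A"
      using u by (cases "A \<in> Poly_Mapping.keys u") (auto simp: lookup_L_0 in_keys_iff)
  qed
  moreover have "u \<in> fock_parity p"
    using u assms even_fock_weight by (auto simp: fock_parity_def)
  ultimately show "u \<in> fock.weight_space (of_nat k / 2) \<inter> fock_parity p"
    by (simp add: fock.weight_space_def)
qed

lemma card_fock_weight: "card {A. fock_weight A = k} = card (odd_partitions k)"
proof (rule bij_betw_same_card[of fset])
  show "bij_betw fset {A. fock_weight A = k} (odd_partitions k)"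
    by (rule bij_betw_byWitness[where f' = Abs_fset])
      (auto simp: fset_inverse Abs_fset_inverse odd_partitions_def fock_weight_def)
qed

lemma dim_weight_space_fock:
  assumes "even k = p"
  shows "fock.dim (fock.weight_space (of_nat k / 2) \<inter> fock_parity p) = card (odd_partitions k)"
proof -
  let ?e = "\<lambda>A. Poly_Mapping.single A 1 :: fock"
  let ?S = "{A. fock_weight A = k}"
  have inj: "inj_on ?e S" for S
    by (rule inj_onI) (metis lookup_single_eq lookup_single_not_eq zero_neq_one)
  show ?thesis unfolding weight_space_fock[OF assms]
  proof (rule fock.dim_unique[where B = "?e ` ?S"])
    show "?e ` ?S \<subseteq> {u :: fock. \<forall>A\<in>Poly_Mapping.keys u. fock_weight A = k}" by auto
    show "{u :: fock. \<forall>A\<in>Poly_Mapping.keys u. fock_weight A = k} \<subseteq> fock.span (?e ` ?S)"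
    proof
      fix u assume u: "u \<in> {u :: fock. \<forall>A\<in>Poly_Mapping.keys u. fock_weight A = k}"
      have "(\<Sum>A\<in>Poly_Mapping.keys u. fock_scale (Poly_Mapping.lookup u A) (?e A)) \<in> fock.span (?e ` ?S)"
        using u by (intro fock.span_sum fock.span_scale fock.span_base) auto
      then show "u \<in> fock.span (?e ` ?S)" using fock_expansion by metis
    qed
    show "fock.independent (?e ` ?S)"
    proof (rule fock.independent_if_scalars_zero)
      have "finite ?S"
        using finite_odd_partitions[of k] 
        by (rule finite_imageD[OF finite_subset, rotated 1, where f = fset]) (auto simp: odd_partitions_def fock_weight_def inj_on_def fset_inject)
      then show "finite (?e ` ?S)" by simp
      fix f x assume zero: "(\<Sum>x\<in>?e ` ?S. fock_scale (f x) x) = 0" and x: "x \<in> ?e ` ?S"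
      then obtain A where A: "x = ?e A" "fock_weight A = k" by auto
      have "0 = Poly_Mapping.lookup (\<Sum>B\<in>?S. fock_scale (f (?e B)) (?e B)) A"
        using zero by (simp add: sum.reindex[OF inj])
      also have "\<dots> = f x"
        using A \<open>finite ?S\<close> by (simp add: lookup_sum lookup_single when_def sum.delta mult_delta_right)
      finally show "f x = 0" by simp
    qed
    show "card (?e ` ?S) = card (odd_partitions k)"
      by (simp add: card_image[OF inj] card_fock_weight)
  qed
qed

lemma ground_highest_weight:
  "fock.highest_weight_vector (1/2) (if p then 0 else 1/2) (ground p)"
proof -
  have "ground p \<noteq> 0"
    by (metis (full_types) ground_def lookup_single_eq lookup_zero psi_neg_one_vac vac_def zero_neq_one)
  moreover have "L n (ground p) = 0" if "n > 0" for n
    using that by (cases p) (simp_all add: ground_def L_vac L_psi psi_vac)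
  moreover have "L 0 (ground p) = fock_scale (if p then 0 else 1/2) (ground p)"
    by (cases p) (simp_all add: ground_def L_vac L_psi)
  ultimately show ?thesis by (simp add: fock.highest_weight_vector_def)
qed

section \<open>The characters\<close>

text \<open>
  The coefficient of \<open>q\<^sup>k\<^sup>/\<^sup>2\<close> is the dimension of the weight space \<open>k/2\<close> when \<open>k\<close> has the parity of \<open>2h\<close>, and \<open>0\<close>
  otherwise.
\<close>

lemma character_eq:
  fixes scale :: "complex \<Rightarrow> 'v::ab_group_add \<Rightarrow> 'v"
  assumes M: "irreducible_highest_weight_module scale act (1/2) h" and h: "h = (if p then 0 else 1/2)"
  shows "virasoro_module.character scale act h =
    inverse (prodinf (\<lambda>i::nat. 1 - (fps_X\<^sup>2) ^ (2 * (i + 1)))) *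
    infsum (\<lambda>n. fps_X ^ nat (2 * n\<^sup>2 + n)) {n::int. even n = p}"
proof -
  interpret M: irreducible_highest_weight_module scale act "1/2" h by fact
  have dim: "M.V.dim (M.weight_space (of_nat k / 2)) = card (odd_partitions k)" if "even k = p" for k
    using dim_weight_space_eq[OF M fock.virasoro_module_axioms ground_highest_weight[of p, folded h]
        submodule_fock_parity ground_parity fock_parity_irreducible] dim_weight_space_fock[OF that] by simp
  have index: "{j. h + of_nat j = of_nat k / 2} = (if even k = p then {k div 2} else {})" for k
  proof -
    have "h + of_nat j = of_nat k / 2 \<longleftrightarrow> 2 * j + (if p then 0 else 1) = k" for j
    proof -
      have "h + of_nat j = complex_of_nat (2 * j + (if p then 0 else 1)) / 2"
        by (simp add: h add_divide_distrib)
      then show ?thesis by (metis divide_cancel_right of_nat_eq_iff zero_neq_numeral)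
    qed
    then show ?thesis by (auto simp: h)
  qed
  have "M.character h = Abs_fps (\<lambda>k. if even k = p then of_nat (card (odd_partitions k)) else 0)"
    unfolding M.character_def
  proof (rule arg_cong[where f = Abs_fps], rule ext)
    fix k
    show "(\<Sum>j | h + of_nat j = of_nat k / 2. of_nat (M.V.dim (M.weight_space (h + of_nat j)))) =
        (if even k = p then complex_of_nat (card (odd_partitions k)) else 0)"
    proof (cases "even k = p")
      case True
      then have "h + of_nat (k div 2) = of_nat k / 2" using index[of k] by auto
      then have "M.V.dim (M.weight_space (h + of_nat (k div 2))) = card (odd_partitions k)"
        by (simp only: dim[OF True])
      then show ?thesis unfolding index using True by simp
    qed (unfold index, simp)
  qed
  then show ?thesis by (simp only: odd_partitions_parity_fps)
qed

theorem proposition3p4: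
  fixes scale :: "complex \<Rightarrow> 'v::ab_group_add \<Rightarrow> 'v"
    and act :: "virasoro \<Rightarrow> 'v \<Rightarrow> 'v"
  shows
    "(irreducible_highest_weight_module scale act (1/2) 0 \<longrightarrow>
        virasoro_module.character scale act 0 =
          inverse (prodinf (\<lambda>i::nat. 1 - (fps_X\<^sup>2) ^ (2 * (i + 1)))) *
          infsum (\<lambda>n. fps_X ^ nat (2 * n\<^sup>2 + n)) {n::int. even n}) \<and>
     (irreducible_highest_weight_module scale act (1/2) (1/2) \<longrightarrow>
        virasoro_module.character scale act (1/2) =
          inverse (prodinf (\<lambda>i::nat. 1 - (fps_X\<^sup>2) ^ (2 * (i + 1)))) *
          infsum (\<lambda>n. fps_X ^ nat (2 * n\<^sup>2 + n)) {n::int. odd n})"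
  using character_eq[of scale act 0 True] character_eq[of scale act "1/2" False] by simp

end
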